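(* Let $p$ be an odd prime, $n\ge 2$, and let $D_n=\mathbb F_p[y_1,\dots,y_n]^{GL(n,\mathbb F_p)}$ and $\mathbb F_p(n-1,1)=\mathbb F_p[y_1,\dots,y_n]^{P(n-1,1)}$. Let $B$ be the free $D_n$-module basis of $\mathbb F_p(n-1,1)$ given by $$B=\{d_{n-1,0}^{m_0}\cdots d_{n-1,n-2}^{m_{n-2}} : 0\le m_i\le p-1\}\ \cup\ \bigcup_{t=1}^{n-1}\{d_{n-1,t-1}^{\,p}\,d_{n-1,t}^{m_t}\cdots d_{n-1,n-2}^{m_{n-2}} : 0\le m_i\le p-1\}.$$ Let $\xi:\mathbb F_p(n-1,1)\to D_n$ be the natural epimorphism with respect to $B$, and let $\tau^*:\mathbb F_p(n-1,1)\to D_n$ be the transfer map. Then $\xi=\tau^*$.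
   Context: $GL(n,\mathbb F_p)$ acts on $\mathbb F_p[y_1,\dots,y_n]$ by algebra automorphisms determined by $(a_{ij})\,y_k=\sum_i a_{ik}y_i$. The parabolic subgroup is $P(k,n-k)=\left\{\begin{pmatrix}A&C\\0&B\end{pmatrix}: A\in GL(k,\mathbb F_p),\ B\in GL(n-k,\mathbb F_p)\right\}$. For $m\ge1$ and $0\le i\le m$ let $L_{m,i}$ be the determinant of the $m\times m$ matrix obtained from the matrix with rows $(y_1^{p^j},\dots,y_m^{p^j})$, $0\le j\le m$, by deleting the row $j=i$; put $L_m=L_{m,m}$ and $d_{m,i}=L_{m,i}/L_m\in\mathbb F_p[y_1,\dots,y_m]$ (the Dickson invariants). Then $D_n=\mathbb F_p[d_{n,0},\dots,d_{n,n-1}]$. The natural epimorphism $\xi$ with respect to a free $D_n$-basis $B$ containing $1$ is the $D_n$-linear map sending $f=\sum_{b\in B}c_b\,b$ (with $c_b\in D_n$) to $c_1$, the coefficient of the basis element $1$. The transfer is $\tau^*(f)=\sum_{g} g f$, where $g$ runs over a set of left coset representatives of $P(n-1,1)$ in $GL(n,\mathbb F_p)$. *)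

theory Defs
  imports
    "Berlekamp_Zassenhaus.Finite_Field"
    "Jordan_Normal_Form.Determinant"
    "HOL-Library.Poly_Mapping"
    "HOL-Library.FuncSet"
begin

(* Monomials are exponent functions nat =>0 nat. Variables and matrix entries are numbered from 0:
   Y k is y_{k+1}, and the polynomials of n variables are those only involving Y 0, ..., Y (n-1). *)
type_synonym 'p fpoly = "(nat \<Rightarrow>\<^sub>0 nat) \<Rightarrow>\<^sub>0 'p mod_ring"

definition Const :: "'p::prime_card mod_ring \<Rightarrow> 'p fpoly" where
  "Const c = Poly_Mapping.single 0 c"

definition Y :: "nat \<Rightarrow> 'p::prime_card fpoly" where
  "Y k = Poly_Mapping.single (Poly_Mapping.single k 1) 1"

definition polys :: "nat \<Rightarrow> 'p::prime_card fpoly set" where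
  "polys n = {f. \<forall>m\<in>Poly_Mapping.keys f. Poly_Mapping.keys m \<subseteq> {..<n}}"

definition GL :: "nat \<Rightarrow> 'p::prime_card mod_ring mat set" where
  "GL n = {A \<in> carrier_mat n n. invertible_mat A}"

definition parabolic :: "nat \<Rightarrow> nat \<Rightarrow> 'p::prime_card mod_ring mat set" where
  "parabolic k l = {four_block_mat A C (0\<^sub>m l k) B | A B C.
     A \<in> GL k \<and> B \<in> GL l \<and> C \<in> carrier_mat k l}"

(* The substitution Y k := \<Sum>i<n. g_{ik} Y i; only meant for g in GL n and f in polys n. *)
definition act :: "nat \<Rightarrow> 'p::prime_card mod_ring mat \<Rightarrow> 'p fpoly \<Rightarrow> 'p fpoly" where
  "act n g f = (\<Sum>m\<in>Poly_Mapping.keys f. Const (Poly_Mapping.lookup f m) *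
     (\<Prod>k<n. (\<Sum>i<n. Const (g $$ (i, k)) * Y i) ^ Poly_Mapping.lookup m k))"

definition invariants :: "nat \<Rightarrow> 'p::prime_card mod_ring mat set \<Rightarrow> 'p fpoly set" where
  "invariants n H = {f \<in> polys n. \<forall>h\<in>H. act n h f = f}"

definition dickson_minor :: "nat \<Rightarrow> nat \<Rightarrow> 'p::prime_card fpoly" where
  "dickson_minor m i =
     det (mat m m (\<lambda>(r, c). Y c ^ (CARD('p) ^ (if r < i then r else Suc r))))"

(* The exact quotient L_{m,i} / L_m in the polynomial ring, which is a domain. *)
definition dickson :: "nat \<Rightarrow> nat \<Rightarrow> 'p::prime_card fpoly" where
  "dickson m i = (THE q. q * dickson_minor m m = dickson_minor m i)"

definition basis_B :: "nat \<Rightarrow> 'p::prime_card fpoly set" where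
  "basis_B n =
     {\<Prod>i<n-1. dickson (n-1) i ^ m i | m. \<forall>i<n-1. m i \<le> CARD('p) - 1} \<union>
     (\<Union>t\<in>{1..n-1}.
       {dickson (n-1) (t-1) ^ CARD('p) * (\<Prod>i\<in>{t..<n-1}. dickson (n-1) i ^ m i) | m.
          \<forall>i\<in>{t..<n-1}. m i \<le> CARD('p) - 1})"

definition expansion :: "'a::comm_ring_1 set \<Rightarrow> 'a set \<Rightarrow> 'a \<Rightarrow> ('a \<Rightarrow> 'a) \<Rightarrow> bool" where
  "expansion D B f c \<longleftrightarrow> c \<in> B \<rightarrow>\<^sub>E D \<and> f = (\<Sum>b\<in>B. c b * b)"

definition finite_free_basis :: "'a::comm_ring_1 set \<Rightarrow> 'a set \<Rightarrow> 'a set \<Rightarrow> bool" where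
  "finite_free_basis D S B \<longleftrightarrow> finite B \<and> B \<subseteq> S \<and> (\<forall>f\<in>S. \<exists>!c. expansion D B f c)"

definition natural_epi :: "'a::comm_ring_1 set \<Rightarrow> 'a set \<Rightarrow> 'a \<Rightarrow> 'a" where
  "natural_epi D B f = (THE c. expansion D B f c) 1"

definition left_coset_reps ::
    "'p::prime_card mod_ring mat set \<Rightarrow> 'p mod_ring mat set \<Rightarrow> 'p mod_ring mat set \<Rightarrow> bool" where
  "left_coset_reps R G H \<longleftrightarrow> R \<subseteq> G \<and> (\<forall>g\<in>G. \<exists>!r. r \<in> R \<and> (\<exists>h\<in>H. g = r * h))"

definition transfer :: "nat \<Rightarrow> 'p::prime_card mod_ring mat set \<Rightarrow> 'p fpoly \<Rightarrow> 'p fpoly" where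
  "transfer n R f = (\<Sum>g\<in>R. act n g f)"

end

theory Submission
  imports Defs "HOL-Computational_Algebra.Polynomial_Factorial"
begin

text \<open>
  Write \<open>n = m + 1\<close> and let \<open>e = top_class m\<close> be the \<open>(p - 1)\<close>-st power of the product of all
  \<open>Y m + w\<close>, with \<open>w\<close> in the span of the first \<open>m\<close> variables. From
  \<open>d_{n,i} = d_{m,i-1}^p + e d_{m,i}\<close> every \<open>d_{m,i}\<close> is a polynomial in \<open>z = 1 / e\<close> of degree
  \<open>1 + p + \<dots> + p^i\<close> over the field of fractions of the Dickson algebra, and \<open>d_{m,m} = 1\<close>
  becomes an equation \<open>F(z) = 0\<close> of degree \<open>N = 1 + p + \<dots> + p^m\<close>. Its roots are the \<open>N\<close>
  conjugates of \<open>z\<close>, one for each coset, and \<open>F'(z) = 1 / z\<close> because the characteristic is \<open>p\<close>.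
  Lagrange interpolation hence expresses the trace of \<open>z q(z)\<close>, for \<open>degree q < N\<close>, by the
  coefficient of \<open>q\<close> at \<open>N - 1\<close>. The elements of the basis have the \<open>z\<close>-degrees
  \<open>0, \<dots>, N - 1\<close>, each exactly once, so all of them except \<open>1\<close> have trace \<open>0\<close>.

  They form a basis because the trace form of \<open>f h / e^m\<close> takes values in the Dickson algebra and
  has, against a suitable second family of invariants, a triangular Gram matrix with diagonal
  entries \<open>1\<close> and \<open>-1\<close>. Integrality of the form is checked at each linear form \<open>l\<close>: by
  invariance \<open>l = Y 0\<close>, and there it follows from the vanishing of power sums over the prime field.
\<close>

subsection \<open>Substitution homomorphisms\<close>

text \<open>Over the field of fractions the distinct degrees in \<open>z\<close> already make the
  products a basis; the obstacle is that the coefficients of an expansion must lie in the Dickson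
  algebra. A triangular Gram matrix with diagonal entries 1 and -1 can be solved without
  denominators, provided that the form is integral on invariants. Its weight is
  \<open>1 / e^m\<close> because the second family, complementary in degree to the basis, needs one
  factor \<open>z\<close> for each of the \<open>m\<close> levels of digits. Since
  \<open>z d_{n,0} = d_{m,0}\<close>, integrality says that \<open>d_{n,0}^m\<close> divides the
  transfer of \<open>f d_{m,0}^m\<close>, and \<open>d_{n,0}\<close> is a product of linear forms,
  which the general linear group permutes up to scalars. The derivative is read off from
  \<open>F = z (d_{n,m} - d_{m,m-1}^p) - 1\<close>: the p-th power has derivative zero, whence
  \<open>z F' = F + 1\<close>.\<close>

lemma additive_induct [case_names zero single add]:
  fixes f :: "'a \<Rightarrow>\<^sub>0 'b::comm_monoid_add"
  assumes "P 0" "\<And>m c. P (Poly_Mapping.single m c)" "\<And>f g. P f \<Longrightarrow> P g \<Longrightarrow> P (f + g)"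
  shows "P f"
proof (induction f rule: update_induct)
  case const
  then show ?case by (rule assms)
next
  case (update f m c)
  have "Poly_Mapping.update m c f = f + Poly_Mapping.single m c"
    using update.hyps
    by (intro poly_mapping_eqI)
       (auto simp: lookup_update lookup_add lookup_single in_keys_iff when_def)
  then show ?case using assms update by metis
qed

lemma Const_0 [simp]: "Const 0 = 0"
  and Const_1 [simp]: "Const 1 = 1"
  and Const_add: "Const (a + b) = Const a + Const b"
  and Const_mult: "Const (a * b) = Const a * Const b"
  and Const_uminus: "Const (- a) = - Const a"
  by (simp_all add: Const_def single_add mult_single single_uminus)

lemma Const_eq_0_iff [simp]: "Const c = 0 \<longleftrightarrow> c = 0"
  by (metis Const_def lookup_single_eq lookup_zero single_zero)

lemma Const_power: "Const (a ^ k) = Const a ^ k"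
  by (induction k) (simp_all add: Const_mult)

lemma Const_sum: "Const (sum f A) = (\<Sum>x\<in>A. Const (f x))"
  by (induction A rule: infinite_finite_induct) (simp_all add: Const_add)

lemma single_eq_Const_mult:
  "(Poly_Mapping.single m c :: 'p::prime_card fpoly) = Const c * Poly_Mapping.single m 1"
  by (simp add: Const_def mult_single)

lemma Y_power: "(Y k :: 'p::prime_card fpoly) ^ j = Poly_Mapping.single (Poly_Mapping.single k j) 1"
  by (induction j) (simp_all add: Y_def mult_single single_add[symmetric])

text \<open>Constants and variables generate the ring, so identities and congruences between ring
  homomorphisms need to be checked on these only.\<close>

lemma fpoly_induct [case_names Const Y add mult]:
  fixes f :: "'p::prime_card fpoly"
  assumes C: "\<And>c. P (Const c)" and Y: "\<And>k. P (Y k)"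
    and A: "\<And>f g. P f \<Longrightarrow> P g \<Longrightarrow> P (f + g)" and M: "\<And>f g. P f \<Longrightarrow> P g \<Longrightarrow> P (f * g)"
  shows "P f"
proof -
  have Yk: "P (Y k ^ j)" for k j
  proof (induction j)
    case 0
    then show ?case using C[of 1] by simp
  next
    case (Suc j)
    then show ?case using Y M by simp
  qed
  have mon: "P (Poly_Mapping.single m 1)" for m
  proof (induction m rule: additive_induct)
    case zero
    then show ?case using C[of 1] by (simp add: Const_def)
  next
    case (single k j)
    then show ?case using Yk[of k j] by (simp add: Y_power)
  next
    case (add a b)
    have "(Poly_Mapping.single (a + b) 1 :: 'p fpoly) = Poly_Mapping.single a 1 * Poly_Mapping.single b 1"
      by (simp add: mult_single)
    then show ?case using M add by simp
  qed
  show ?thesis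
  proof (induction f rule: additive_induct)
    case zero
    then show ?case using C[of 0] by simp
  next
    case (single m c)
    then show ?case using M[OF C mon] single_eq_Const_mult by metis
  qed (rule A)
qed

text \<open>One evaluation homomorphism that specializes to \<open>act\<close>, to
  \<open>kill\<close> and to the shears. Multiplying over the keys of each monomial makes it total
  on polynomials in infinitely many variables.\<close>

definition subst :: "(nat \<Rightarrow> 'p fpoly) \<Rightarrow> 'p::prime_card fpoly \<Rightarrow> 'p fpoly" where
  "subst s f = (\<Sum>m\<in>Poly_Mapping.keys f. Const (Poly_Mapping.lookup f m) *
     (\<Prod>k\<in>Poly_Mapping.keys m. s k ^ Poly_Mapping.lookup m k))"

lemma monomial_value_superset:
  fixes s :: "nat \<Rightarrow> 'b::comm_semiring_1"
  assumes "finite A" "\<And>k. k \<in> Poly_Mapping.keys m \<Longrightarrow> k \<notin> A \<Longrightarrow> s k = 1"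
  shows "(\<Prod>k\<in>Poly_Mapping.keys m. s k ^ Poly_Mapping.lookup m k) =
    (\<Prod>k\<in>A. s k ^ Poly_Mapping.lookup m k)"
proof -
  have "(\<Prod>k\<in>Poly_Mapping.keys m. s k ^ Poly_Mapping.lookup m k) =
      (\<Prod>k\<in>Poly_Mapping.keys m \<union> A. s k ^ Poly_Mapping.lookup m k)"
    using assms(1) by (intro prod.mono_neutral_left) (auto simp: in_keys_iff)
  also have "\<dots> = (\<Prod>k\<in>A. s k ^ Poly_Mapping.lookup m k)"
    using assms by (intro prod.mono_neutral_right) auto
  finally show ?thesis .
qed

lemma subst_0: "subst s 0 = 0"
  by (simp add: subst_def)

lemma subst_single:
  "subst s (Poly_Mapping.single m c) =
     Const c * (\<Prod>k\<in>Poly_Mapping.keys m. s k ^ Poly_Mapping.lookup m k)"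
  by (cases "c = 0") (simp_all add: subst_def)

lemma subst_add: "subst s (f + g) = subst s f + subst s g"
  unfolding subst_def
  by (rule setsum_keys_plus_distrib) (simp_all add: Const_add algebra_simps)

lemma subst_mult: "subst s (f * g) = subst s f * subst s g"
proof (induction f rule: additive_induct)
  case (single m c)
  show ?case
  proof (induction g rule: additive_induct)
    case (single m' c')
    have "(\<Prod>k\<in>Poly_Mapping.keys (m + m'). s k ^ Poly_Mapping.lookup (m + m') k) =
       (\<Prod>k\<in>Poly_Mapping.keys m \<union> Poly_Mapping.keys m'. s k ^ Poly_Mapping.lookup (m + m') k)"
      by (rule prod.mono_neutral_left) (use keys_add[of m m'] in \<open>auto simp: in_keys_iff\<close>)
    also have "\<dots> =
       (\<Prod>k\<in>Poly_Mapping.keys m \<union> Poly_Mapping.keys m'. s k ^ Poly_Mapping.lookup m k) *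
       (\<Prod>k\<in>Poly_Mapping.keys m \<union> Poly_Mapping.keys m'. s k ^ Poly_Mapping.lookup m' k)"
      by (simp add: lookup_add power_add prod.distrib)
    also have "(\<Prod>k\<in>Poly_Mapping.keys m \<union> Poly_Mapping.keys m'. s k ^ Poly_Mapping.lookup m k) =
       (\<Prod>k\<in>Poly_Mapping.keys m. s k ^ Poly_Mapping.lookup m k)"
      by (rule prod.mono_neutral_right) (auto simp: in_keys_iff)
    also have "(\<Prod>k\<in>Poly_Mapping.keys m \<union> Poly_Mapping.keys m'. s k ^ Poly_Mapping.lookup m' k) =
       (\<Prod>k\<in>Poly_Mapping.keys m'. s k ^ Poly_Mapping.lookup m' k)"
      by (rule prod.mono_neutral_right) (auto simp: in_keys_iff)
    finally show ?case by (simp add: mult_single subst_single Const_mult mult_ac add.commute[of m'])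
  qed (simp_all add: subst_0 subst_add algebra_simps)
qed (simp_all add: subst_0 subst_add algebra_simps)

lemma subst_Const [simp]: "subst s (Const c) = Const c"
  by (simp add: Const_def subst_single)

lemma subst_Y [simp]: "subst s (Y k) = s k"
  by (simp add: Y_def subst_single)

interpretation subst: comm_ring_hom "subst s" for s
  by standard (simp_all add: subst_0 subst_add subst_mult del: Const_1, metis Const_1 subst_Const)

lemma subst_cong:
  assumes "f \<in> polys n" "\<And>k. k < n \<Longrightarrow> s k = t k"
  shows "subst s f = subst t f"
  unfolding subst_def
proof (intro sum.cong prod.cong arg_cong2[where f = "(*)"] refl)
  fix m k assume "m \<in> Poly_Mapping.keys f" "k \<in> Poly_Mapping.keys m"
  with assms(1) have "k < n" by (auto simp: polys_def)
  then show "s k ^ Poly_Mapping.lookup m k = t k ^ Poly_Mapping.lookup m k"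
    using assms(2) by simp
qed

lemma subst_Y_id: "subst Y f = f"
  by (induction f rule: fpoly_induct) (simp_all add: subst.hom_add subst.hom_mult)

definition lin_form :: "nat \<Rightarrow> (nat \<Rightarrow> 'p mod_ring) \<Rightarrow> 'p::prime_card fpoly" where
  "lin_form n v = (\<Sum>i<n. Const (v i) * Y i)"

text \<open>\<open>act n g\<close> ignores the variables from \<open>Y n\<close> on, which amounts
  to substituting 1 for them. Hence it is a ring homomorphism everywhere and not only on
  \<open>polys n\<close>.\<close>

lemma act_eq_subst:
  "act n g = subst (\<lambda>k. if k < n then lin_form n (\<lambda>i. g $$ (i, k)) else 1)"
  unfolding act_def subst_def lin_form_def
  by (intro ext sum.cong arg_cong2[where f = "(*)"] refl)
     (subst monomial_value_superset[of "{..<n}"], auto)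

interpretation act: comm_ring_hom "act n g" for n g
  unfolding act_eq_subst ..

lemma act_Const [simp]: "act n g (Const c) = Const c"
  by (simp add: act_eq_subst)

lemma act_Y: "k < n \<Longrightarrow> act n g (Y k) = lin_form n (\<lambda>i. g $$ (i, k))"
  by (simp add: act_eq_subst)

lemma act_Y_ge: "\<not> k < n \<Longrightarrow> act n g (Y k) = 1"
  by (simp add: act_eq_subst)

lemma act_lin_form:
  assumes "g \<in> carrier_mat n n"
  shows "act n g (lin_form n v) = lin_form n (\<lambda>i. \<Sum>k<n. g $$ (i, k) * v k)"
proof -
  have "act n g (lin_form n v) = (\<Sum>k<n. \<Sum>i<n. Const (v k) * (Const (g $$ (i, k)) * Y i))"
    by (simp add: lin_form_def act.hom_sum act.hom_mult act_Y sum_distrib_left)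
  also have "\<dots> = (\<Sum>i<n. \<Sum>k<n. Const (v k) * (Const (g $$ (i, k)) * Y i))"
    by (rule sum.swap)
  also have "\<dots> = lin_form n (\<lambda>i. \<Sum>k<n. g $$ (i, k) * v k)"
    by (simp add: lin_form_def Const_sum sum_distrib_right sum_distrib_left Const_mult mult_ac)
  finally show ?thesis .
qed

lemma act_act:
  assumes "g \<in> carrier_mat n n" "h \<in> carrier_mat n n"
  shows "act n g (act n h f) = act n (g * h) f"
proof (induction f rule: fpoly_induct)
  case (Y k)
  show ?case
  proof (cases "k < n")
    case True
    have "act n g (act n h (Y k)) = lin_form n (\<lambda>i. \<Sum>j<n. g $$ (i, j) * h $$ (j, k))"
      using True assms by (simp add: act_Y act_lin_form)
    also have "\<dots> = lin_form n (\<lambda>i. (g * h) $$ (i, k))"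
      unfolding lin_form_def using assms True
      by (intro sum.cong) (auto simp: scalar_prod_def lessThan_atLeast0)
    finally show ?thesis using True by (simp add: act_Y)
  qed (simp add: act_Y_ge)
qed (simp_all add: act.hom_add act.hom_mult)

lemma lin_form_unit: "k < n \<Longrightarrow> lin_form n (\<lambda>i. if i = k then 1 else 0) = Y k"
  unfolding lin_form_def
  by (subst sum.remove[of _ k]) auto

lemma lin_form_cong: "(\<And>i. i < n \<Longrightarrow> v i = w i) \<Longrightarrow> lin_form n v = lin_form n w"
  by (simp add: lin_form_def)

lemma act_one_Y: "k < n \<Longrightarrow> act n (1\<^sub>m n) (Y k) = Y k"
proof -
  assume k: "k < n"
  have "lin_form n (\<lambda>i. 1\<^sub>m n $$ (i, k)) = lin_form n (\<lambda>i. if i = k then 1 else 0)"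
    using k by (intro lin_form_cong) simp
  then show ?thesis using k by (simp add: act_Y lin_form_unit)
qed

lemma polys_0: "0 \<in> polys n" and polys_Const: "Const c \<in> polys n"
  by (auto simp: polys_def Const_def)

lemma polys_add: "f \<in> polys n \<Longrightarrow> g \<in> polys n \<Longrightarrow> f + g \<in> polys n"
  using keys_add[of f g] by (fastforce simp: polys_def)

lemma polys_mult: "f \<in> polys n \<Longrightarrow> g \<in> polys n \<Longrightarrow> f * g \<in> polys n"
proof -
  assume fg: "f \<in> polys n" "g \<in> polys n"
  have "Poly_Mapping.keys m \<subseteq> {..<n}" if m: "m \<in> Poly_Mapping.keys (f * g)" for m
  proof -
    from m obtain a b where "m = a + b" "a \<in> Poly_Mapping.keys f" "b \<in> Poly_Mapping.keys g"
      using keys_mult[of f g] by auto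
    then show ?thesis using fg keys_add[of a b] by (fastforce simp: polys_def)
  qed
  then show ?thesis by (simp add: polys_def)
qed

lemma polys_sum: "(\<And>x. x \<in> A \<Longrightarrow> f x \<in> polys n) \<Longrightarrow> sum f A \<in> polys n"
  by (induction A rule: infinite_finite_induct) (auto intro: polys_0 polys_add)

lemma polys_Y: "k < n \<Longrightarrow> Y k \<in> polys n"
  by (simp add: polys_def Y_def)

lemma polys_lin_form: "lin_form n v \<in> polys n"
  unfolding lin_form_def by (intro polys_sum polys_mult polys_Const polys_Y) simp

lemma act_in_polys: "act n g f \<in> polys n"
proof (induction f rule: fpoly_induct)
  case (Y k)
  then show ?case
    using polys_lin_form polys_Const[of 1 n] by (cases "k < n") (simp_all add: act_Y act_Y_ge)
qed (simp_all add: polys_Const act.hom_add act.hom_mult polys_add polys_mult)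

text \<open>The identity matrix sets the variables from \<open>Y n\<close> on to 1, so it acts as a
  retraction onto \<open>polys n\<close>. Membership in \<open>polys n\<close> thereby becomes one
  of the fixed point equations of a set of matrices that contains the identity.\<close>

lemma polys_iff_act_one: "f \<in> polys n \<longleftrightarrow> act n (1\<^sub>m n) f = f"
proof
  assume "f \<in> polys n"
  then have "act n (1\<^sub>m n) f = subst Y f"
    unfolding act_eq_subst by (rule subst_cong) (simp add: act_one_Y flip: act_Y)
  then show "act n (1\<^sub>m n) f = f" by (simp add: subst_Y_id)
next
  assume "act n (1\<^sub>m n) f = f"
  then show "f \<in> polys n" using act_in_polys by metis
qed

lemma one_in_GL: "1\<^sub>m n \<in> GL n"
  unfolding GL_def invertible_mat_def by (auto intro!: exI[of _ "1\<^sub>m n"] simp: inverts_mat_def)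

lemma invariants_altdef:
  assumes "1\<^sub>m n \<in> H"
  shows "invariants n H = {f. \<forall>h\<in>H. act n h f = f}"
  using assms by (auto simp: invariants_def polys_iff_act_one)

subsection \<open>Additive polynomials and Dickson invariants\<close>

lemma CHAR_fpoly: "CHAR('p::prime_card fpoly) = CARD('p)"
proof (rule CHAR_eqI)
  show "of_nat (CARD('p)) = (0 :: 'p fpoly)"
    by (simp flip: single_of_nat)
next
  fix k assume "of_nat k = (0 :: 'p fpoly)"
  then have "Poly_Mapping.lookup (of_nat k :: 'p fpoly) 0 = 0" by simp
  then have "of_nat k = (0 :: 'p mod_ring)" by (simp add: lookup_of_nat)
  then show "CARD('p) dvd k" by (rule of_nat_0_mod_ring_dvd)
qed

lemma CHAR_fpoly_prime: "prime CHAR('p::prime_card fpoly)"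
  by (simp add: CHAR_fpoly prime_card)

lemmas frobenius_add = freshmans_dream'[OF CHAR_fpoly_prime, unfolded CHAR_fpoly]
lemmas frobenius_sum = freshmans_dream_sum'[OF CHAR_fpoly_prime, unfolded CHAR_fpoly]

lemma mod_ring_power_card: "(c :: 'p::prime_card mod_ring) ^ (CARD('p) ^ k) = c"
  by (rule finite_field_power_card_power_eq_same[of _ k]) simp

lemma Const_frobenius: "(Const c :: 'p::prime_card fpoly) ^ (CARD('p) ^ k) = Const c"
  by (simp add: mod_ring_power_card flip: Const_power)

definition additive_poly :: "(nat \<Rightarrow> 'p fpoly) \<Rightarrow> nat \<Rightarrow> 'p::prime_card fpoly \<Rightarrow> 'p fpoly" where
  "additive_poly a k x = (\<Sum>i\<le>k. a i * x ^ (CARD('p) ^ i))"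

lemma additive_poly_add: "additive_poly a k (x + y) = additive_poly a k x + additive_poly a k y"
  by (simp add: additive_poly_def frobenius_add algebra_simps sum.distrib)

lemma additive_poly_0 [simp]: "additive_poly a k (0 :: 'p::prime_card fpoly) = 0"
  using prime_gt_0_nat[OF prime_card[where ?'a = 'p]] by (simp add: additive_poly_def power_0_left)

lemma additive_poly_sum: "additive_poly a k (sum f A) = (\<Sum>x\<in>A. additive_poly a k (f x))"
  by (induction A rule: infinite_finite_induct) (simp_all add: additive_poly_add)

lemma additive_poly_scale: "additive_poly a k (Const c * x) = Const c * additive_poly a k x"
  by (simp add: additive_poly_def power_mult_distrib Const_frobenius sum_distrib_left algebra_simps)

lemma additive_poly_lin_form:
  "additive_poly a k (lin_form n v) = (\<Sum>i<n. Const (v i) * additive_poly a k (Y i))"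
  by (simp add: lin_form_def additive_poly_sum additive_poly_scale)

text \<open>The additive polynomial whose roots are the linear forms in the first \<open>m\<close> variables.\<close>

fun span_coeff :: "nat \<Rightarrow> nat \<Rightarrow> 'p::prime_card fpoly" where
  "span_coeff 0 i = (if i = 0 then 1 else 0)"
| "span_coeff (Suc m) i = (if i = 0 then 0 else span_coeff m (i - 1) ^ CARD('p)) -
     (\<Sum>j\<le>m. span_coeff m j * Y m ^ (CARD('p) ^ j)) ^ (CARD('p) - 1) * span_coeff m i"

definition span_poly :: "nat \<Rightarrow> 'p::prime_card fpoly \<Rightarrow> 'p fpoly" where
  "span_poly m = additive_poly (span_coeff m) m"

definition top_class :: "nat \<Rightarrow> 'p::prime_card fpoly" where
  "top_class m = span_poly m (Y m) ^ (CARD('p) - 1)"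

lemma span_coeff_Suc:
  "span_coeff (Suc m) i = (if i = 0 then 0 else span_coeff m (i - 1) ^ CARD('p)) -
     top_class m * (span_coeff m i :: 'p::prime_card fpoly)"
  by (simp add: span_poly_def top_class_def additive_poly_def)

declare span_coeff.simps(2) [simp del]

lemma CARD_gt_1: "CARD('p::prime_card) > 1"
  using prime_card prime_gt_1_nat by blast

lemma span_coeff_gt: "m < i \<Longrightarrow> span_coeff m i = (0 :: 'p::prime_card fpoly)"
  using CARD_gt_1[where ?'p = 'p]
  by (induction m arbitrary: i) (auto simp: span_coeff_Suc power_0_left)

lemma span_coeff_diag [simp]: "span_coeff m m = 1"
  by (induction m) (auto simp: span_coeff_Suc span_coeff_gt)

text \<open>Composition of \<open>span_poly m\<close> with t^p - v^(p-1) t, where v is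
  \<open>span_poly m (Y m)\<close>. The roots of the latter are the multiples of v, which is how
  \<open>Y m\<close> joins the space of roots.\<close>

lemma span_poly_Suc:
  "span_poly (Suc m) x = span_poly m x ^ CARD('p) - top_class m * (span_poly m x :: 'p::prime_card fpoly)"
proof -
  have "span_poly (Suc m) x =
      (\<Sum>i\<le>Suc m. (if i = 0 then 0 else span_coeff m (i - 1) ^ CARD('p)) * x ^ (CARD('p) ^ i))
      - top_class m * (\<Sum>i\<le>Suc m. span_coeff m i * x ^ (CARD('p) ^ i))"
    by (simp only: span_poly_def additive_poly_def span_coeff_Suc left_diff_distrib
        sum_subtractf sum_distrib_left mult.assoc)
  also have "(\<Sum>i\<le>Suc m. span_coeff m i * x ^ (CARD('p) ^ i)) = span_poly m x"
    by (simp add: span_coeff_gt span_poly_def additive_poly_def)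
  also have "(\<Sum>i\<le>Suc m. (if i = 0 then 0 else span_coeff m (i - 1) ^ CARD('p)) * x ^ (CARD('p) ^ i))
      = (\<Sum>i\<le>m. span_coeff m i ^ CARD('p) * x ^ (CARD('p) ^ Suc i))"
    by (simp only: sum.atMost_Suc_shift) simp
  also have "\<dots> = (\<Sum>i\<le>m. (span_coeff m i * x ^ (CARD('p) ^ i)) ^ CARD('p))"
    by (simp add: power_mult_distrib mult.commute flip: power_mult)
  also have "\<dots> = span_poly m x ^ CARD('p)"
    unfolding span_poly_def additive_poly_def by (rule frobenius_sum[where n = 1, symmetric]) simp
  finally show ?thesis .
qed

lemma span_poly_0: "span_poly 0 x = x"
  by (simp add: span_poly_def additive_poly_def)

lemma span_poly_Y: "j < m \<Longrightarrow> span_poly m (Y j) = (0 :: 'p::prime_card fpoly)"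
proof (induction m)
  case (Suc m)
  have p: "CARD('p) = Suc (CARD('p) - 1)" using CARD_gt_1[where ?'p = 'p] by simp
  have "(span_poly m (Y m) :: 'p fpoly) ^ CARD('p) = top_class m * span_poly m (Y m)"
    unfolding top_class_def by (subst p) (simp only: power_Suc mult.commute)
  then show ?case
    using Suc CARD_gt_1[where ?'p = 'p]
    by (cases "j = m") (auto simp: span_poly_Suc power_0_left)
qed simp

text \<open>If the first \<open>m\<close> variables vanish, so do all roots, and the additive
  polynomial collapses to x^(p^m). This is what keeps \<open>span_poly m (Y m)\<close> from being
  zero.\<close>

lemma subst_span_coeff:
  fixes s :: "nat \<Rightarrow> 'p::prime_card fpoly"
  assumes "\<And>j. j < m \<Longrightarrow> s j = 0" "i < m"
  shows "subst s (span_coeff m i) = 0"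
  using assms
proof (induction m arbitrary: i)
  case (Suc m)
  have z: "subst s (span_coeff m j) = 0" if "j < m" for j
    using that Suc by simp
  have "subst s (span_poly m (Y m)) = (\<Sum>j\<le>m. 0)"
    using Suc.prems(1)[of m] CARD_gt_1[where ?'p = 'p] unfolding span_poly_def additive_poly_def
    by (simp add: subst.hom_sum subst.hom_mult subst.hom_power power_0_left)
  then have "subst s (top_class m) = 0"
    using CARD_gt_1[where ?'p = 'p] by (simp add: top_class_def subst.hom_power power_0_left)
  moreover have "subst s (span_coeff m (i - 1)) ^ CARD('p) = 0" if "i \<noteq> 0"
    using that Suc.prems z[of "i - 1"] CARD_gt_1[where ?'p = 'p] by (simp add: power_0_left)
  ultimately show ?case
    by (simp add: span_coeff_Suc subst.hom_minus subst.hom_mult subst.hom_power)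
qed simp

lemma span_poly_Y_nonzero: "span_poly m (Y m) \<noteq> (0 :: 'p::prime_card fpoly)"
proof
  let ?s = "\<lambda>j. if j < m then 0 else (Y j :: 'p fpoly)"
  assume "span_poly m (Y m) = (0 :: 'p fpoly)"
  then have "0 = subst ?s (span_poly m (Y m))" by simp
  also have "\<dots> = (\<Sum>i\<le>m. subst ?s (span_coeff m i) * Y m ^ (CARD('p) ^ i))"
    by (simp add: span_poly_def additive_poly_def subst.hom_sum subst.hom_mult subst.hom_power)
  also have "\<dots> = Y m ^ (CARD('p) ^ m)"
    by (simp add: subst_span_coeff atMost_Suc flip: lessThan_Suc_atMost)
  finally show False by (metis Y_power lookup_single_eq lookup_zero zero_neq_one)
qed

lemma top_class_nonzero: "top_class m \<noteq> (0 :: 'p::prime_card fpoly)"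
  by (simp add: top_class_def span_poly_Y_nonzero)

text \<open>A nonzero additive polynomial of degree at most p^k cannot vanish at k + 1 independent
  forms. Division by \<open>span_poly (Suc k)\<close> leaves a remainder \<open>b\<close> to which
  the induction applies; the quotient \<open>a (Suc k)\<close> is then zero because
  \<open>span_poly (Suc k)\<close> does not vanish at \<open>Y (Suc k)\<close>.\<close>

lemma additive_poly_unique:
  fixes a :: "nat \<Rightarrow> 'p::prime_card fpoly"
  assumes "\<And>j. j \<le> k \<Longrightarrow> additive_poly a k (Y j) = 0" "i \<le> k"
  shows "a i = 0"
  using assms
proof (induction k arbitrary: a i)
  case 0
  then have "a 0 * Y 0 = 0" by (simp add: additive_poly_def)
  moreover have "(Y 0 :: 'p fpoly) \<noteq> 0" using span_poly_Y_nonzero[of 0] by (simp add: span_poly_0)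
  ultimately show ?case using 0 by simp
next
  case (Suc k)
  define b where "b = (\<lambda>i. a i - a (Suc k) * span_coeff (Suc k) i)"
  have b: "additive_poly b k x = additive_poly a (Suc k) x - a (Suc k) * span_poly (Suc k) x" for x
    by (simp add: b_def additive_poly_def span_poly_def sum_subtractf sum_distrib_left algebra_simps)
  have bz: "b i = 0" if "i \<le> k" for i
    by (rule Suc.IH) (use that Suc.prems in \<open>simp_all add: b span_poly_Y\<close>)
  have "0 = additive_poly b k (Y (Suc k))"
    by (simp add: additive_poly_def bz)
  also have "\<dots> = - (a (Suc k) * span_poly (Suc k) (Y (Suc k)))"
    using Suc.prems by (simp add: b)
  finally have "a (Suc k) = 0" by (simp add: span_poly_Y_nonzero)
  then show ?case using bz[of i] Suc.prems(2) by (cases "i = Suc k") (auto simp: b_def)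
qed

section \<open>Moore determinants, and the Dickson invariants as coefficients of an additive
  polynomial\<close>

definition moore_mat :: "nat \<Rightarrow> (nat \<Rightarrow> 'p fpoly) \<Rightarrow> 'p::prime_card fpoly mat" where
  "moore_mat m w = mat m m (\<lambda>(r, c). w c ^ (CARD('p) ^ r))"

text \<open>Laplace expansion along the last column, which carries the powers of \<open>x\<close>.
  The cofactors are the minors in the definition of the Dickson invariants, so these become
  coefficients of an additive polynomial whose roots come from repeated columns.\<close>

lemma det_moore_mat_expand:
  fixes x :: "'p::prime_card fpoly"
  shows "det (moore_mat (Suc m) (Y(m := x))) =
    additive_poly (\<lambda>i. (-1) ^ (i + m) * dickson_minor m i) m x"
proof -
  let ?M = "moore_mat (Suc m) (Y(m := x))"
  have "det ?M = (\<Sum>i<Suc m. ?M $$ (i, m) * cofactor ?M i m)"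
    by (rule laplace_expansion_column) (auto simp: moore_mat_def)
  also have "\<dots> = (\<Sum>i\<le>m. (-1) ^ (i + m) * dickson_minor m i * x ^ (CARD('p) ^ i))"
    unfolding lessThan_Suc_atMost
  proof (intro sum.cong refl)
    fix i assume "i \<in> {..m}"
    then have "mat_delete ?M i m = mat m m (\<lambda>(r, c). Y c ^ (CARD('p) ^ (if r < i then r else Suc r)))"
      by (intro eq_matI) (auto simp: mat_delete_def moore_mat_def)
    then show "?M $$ (i, m) * cofactor ?M i m = (-1) ^ (i + m) * dickson_minor m i * x ^ (CARD('p) ^ i)"
      using \<open>i \<in> {..m}\<close> by (simp add: cofactor_def dickson_minor_def moore_mat_def mult_ac)
  qed
  finally show ?thesis by (simp add: additive_poly_def)
qed

lemma det_moore_mat_repeated: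
  assumes "j < m"
  shows "det (moore_mat (Suc m) (Y(m := Y j))) = (0 :: 'p::prime_card fpoly)"
proof (rule det_identical_columns)
  let ?M = "moore_mat (Suc m) (Y(m := Y j)) :: 'p fpoly mat"
  show M: "?M \<in> carrier_mat (Suc m) (Suc m)" by (simp add: moore_mat_def)
  show "j \<noteq> m" "j < Suc m" "m < Suc m" using assms by simp_all
  have *: "?M $$ (r, j) = ?M $$ (r, m)" if "r < Suc m" for r
    unfolding moore_mat_def using assms that by (subst (1 2) index_mat(1)) auto
  show "col ?M j = col ?M m"
    unfolding col_def using * M by (intro eq_vecI) auto
qed

text \<open>Two additive polynomials of degree p^m with the same top coefficient and the common
  roots \<open>Y 0\<close>, ..., \<open>Y (m - 1)\<close> coincide, since their difference has too
  many independent roots.\<close>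

lemma dickson_minor_eq:
  assumes "i \<le> m"
  shows "(-1) ^ (i + m) * dickson_minor m i = dickson_minor m m * (span_coeff m i :: 'p::prime_card fpoly)"
proof (cases "i = m")
  case True
  then show ?thesis by (simp flip: mult_2)
next
  case False
  define b where "b = (\<lambda>i. (-1) ^ (i + m) * dickson_minor m i - dickson_minor m m * (span_coeff m i :: 'p fpoly))"
  obtain k where k: "m = Suc k" using assms False by (cases m) auto
  have "additive_poly b k (Y j) = 0" if "j \<le> k" for j
  proof -
    have eq: "additive_poly b m x = additive_poly (\<lambda>i. (-1) ^ (i + m) * dickson_minor m i) m x
        - dickson_minor m m * span_poly m x" for x
      by (simp only: b_def additive_poly_def span_poly_def sum_subtractf sum_distrib_left
          left_diff_distrib mult.assoc)
    have j: "j < m" using that k by simp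
    have "b m = 0" by (simp add: b_def flip: mult_2)
    then have "additive_poly b k (Y j) = additive_poly b m (Y j)"
      by (simp add: k additive_poly_def)
    also have "\<dots> = det (moore_mat (Suc m) (Y(m := Y j)))"
      by (simp add: eq det_moore_mat_expand span_poly_Y[OF j])
    also have "\<dots> = 0"
      using j by (rule det_moore_mat_repeated)
    finally show ?thesis .
  qed
  then have "b i = 0" by (rule additive_poly_unique[of k]) (use assms False k in simp_all)
  then show ?thesis by (simp add: b_def)
qed

text \<open>Taking \<open>x = Y m\<close> in the expansion gives L_{m+1} as the product of L_m and
  \<open>span_poly m (Y m)\<close>.\<close>

lemma dickson_minor_nonzero: "dickson_minor m m \<noteq> (0 :: 'p::prime_card fpoly)"
proof (induction m)
  case 0
  then show ?case by (simp add: dickson_minor_def)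
next
  case (Suc m)
  have "dickson_minor (Suc m) (Suc m) = det (moore_mat (Suc m) (Y(m := Y m)) :: 'p fpoly mat)"
    unfolding dickson_minor_def moore_mat_def by (intro arg_cong[of _ _ det] cong_mat) auto
  also have "\<dots> = (\<Sum>i\<le>m. dickson_minor m m * span_coeff m i * Y m ^ (CARD('p) ^ i))"
    unfolding det_moore_mat_expand additive_poly_def by (intro sum.cong) (simp_all add: dickson_minor_eq)
  also have "\<dots> = dickson_minor m m * span_poly m (Y m)"
    by (simp add: span_poly_def additive_poly_def sum_distrib_left mult.assoc)
  finally show ?case using Suc span_poly_Y_nonzero[of m] by simp
qed

text \<open>Besides identifying the quotient this shows that the division is exact; uniqueness in
  \<open>THE\<close> is cancellation of the nonzero L_m.\<close>

lemma dickson_eq: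
  assumes "i \<le> m"
  shows "dickson m i = (-1) ^ (i + m) * (span_coeff m i :: 'p::prime_card fpoly)"
  unfolding dickson_def
proof (rule the_equality)
  have sq: "(-1) ^ (i + m) * ((-1) ^ (i + m) * x) = (x :: 'p fpoly)" for x
    by (simp flip: mult.assoc power_add mult_2)
  have "(-1) ^ (i + m) * span_coeff m i * dickson_minor m m =
      (-1) ^ (i + m) * (dickson_minor m m * span_coeff m i :: 'p fpoly)"
    by (simp add: mult_ac)
  also have "\<dots> = dickson_minor m i"
    by (simp only: sq flip: dickson_minor_eq[OF assms])
  finally show *: "(-1) ^ (i + m) * span_coeff m i * dickson_minor m m = (dickson_minor m i :: 'p fpoly)" .
  fix q :: "'p fpoly" assume "q * dickson_minor m m = dickson_minor m i"
  then show "q = (-1) ^ (i + m) * span_coeff m i"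
    using * dickson_minor_nonzero[of m] by (metis mult_right_cancel)
qed

lemma dickson_diag [simp]: "dickson m m = 1"
  by (simp add: dickson_eq flip: mult_2)

lemma dickson_Suc_0: "dickson (Suc m) 0 = top_class m * (dickson m 0 :: 'p::prime_card fpoly)"
  by (simp add: dickson_eq span_coeff_Suc)

text \<open>The sign lies in the prime field and is fixed by the p-th power; the minus sign in front
  of \<open>top_class\<close> is absorbed by the change of parity from \<open>i\<close> to
  \<open>Suc i\<close>.\<close>

lemma dickson_Suc_Suc:
  assumes "i < m"
  shows "dickson (Suc m) (Suc i) = dickson m i ^ CARD('p) + top_class m * (dickson m (Suc i) :: 'p::prime_card fpoly)"
proof -
  have "((-1) ^ (i + m) * span_coeff m i :: 'p fpoly) ^ CARD('p) = (-1) ^ (i + m) * span_coeff m i ^ CARD('p)"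
    using Const_frobenius[of "(-1) ^ (i + m) :: 'p mod_ring" 1]
    by (simp add: power_mult_distrib Const_power Const_uminus)
  then show ?thesis using assms
    by (simp add: dickson_eq span_coeff_Suc right_diff_distrib mult.left_commute)
qed

subsection \<open>Invariants of the general linear and the parabolic group\<close>

lemma GL_carrier: "g \<in> GL n \<Longrightarrow> g \<in> carrier_mat n n"
  by (simp add: GL_def)

lemma GL_inverse:
  assumes "g \<in> GL n"
  obtains h where "h \<in> GL n" "g * h = 1\<^sub>m n" "h * g = 1\<^sub>m n"
proof -
  from assms obtain h where h: "inverts_mat g h" "inverts_mat h g" and g: "g \<in> carrier_mat n n"
    by (auto simp: GL_def invertible_mat_def)
  from h g have gh: "g * h = 1\<^sub>m n" and hg: "h * g = 1\<^sub>m (dim_row h)"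
    by (auto simp: inverts_mat_def)
  have "dim_col h = n" using arg_cong[OF gh, of dim_col] by simp
  moreover have "dim_row h = n" using arg_cong[OF hg, of dim_col] g by simp
  ultimately have hc: "h \<in> carrier_mat n n" by auto
  then have "h \<in> GL n" using h unfolding GL_def invertible_mat_def by auto
  then show ?thesis using that gh hg hc by auto
qed

lemma GL_I:
  assumes "g \<in> carrier_mat n n" "h \<in> carrier_mat n n" "g * h = 1\<^sub>m n" "h * g = 1\<^sub>m n"
  shows "g \<in> GL n"
  using assms unfolding GL_def invertible_mat_def inverts_mat_def by auto

lemma GL_iff_det: "g \<in> GL n \<longleftrightarrow> g \<in> carrier_mat n n \<and> det g \<noteq> 0"
proof
  assume g: "g \<in> GL n"
  then obtain h where h: "h \<in> GL n" "g * h = 1\<^sub>m n" by (rule GL_inverse)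
  then have "det g * det h = 1"
    using det_mult[OF GL_carrier[OF g] GL_carrier[OF h(1)]] by simp
  then have "det g \<noteq> 0" by (metis mult_zero_left zero_neq_one)
  then show "g \<in> carrier_mat n n \<and> det g \<noteq> 0" using GL_carrier[OF g] by blast
next
  assume g: "g \<in> carrier_mat n n \<and> det g \<noteq> 0"
  then have "g \<in> Units (ring_mat TYPE('a mod_ring) n ())"
    by (intro det_non_zero_imp_unit) auto
  then obtain h where "h \<in> carrier_mat n n" "h * g = 1\<^sub>m n" "g * h = 1\<^sub>m n"
    by (auto simp: Units_def ring_mat_def)
  then show "g \<in> GL n" using g GL_I by blast
qed

lemma GL_mult: "g \<in> GL n \<Longrightarrow> h \<in> GL n \<Longrightarrow> g * h \<in> GL n"
  by (auto simp: GL_iff_det det_mult)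

lemma index_mult_mat_sum:
  "g \<in> carrier_mat n n \<Longrightarrow> h \<in> carrier_mat n n \<Longrightarrow> i < n \<Longrightarrow> j < n \<Longrightarrow>
    (g * h) $$ (i, j) = (\<Sum>k<n. g $$ (i, k) * h $$ (k, j))"
  by (auto simp: scalar_prod_def lessThan_atLeast0)

lemma parabolicI:
  "g = four_block_mat A C (0\<^sub>m l k) B \<Longrightarrow> A \<in> GL k \<Longrightarrow> B \<in> GL l \<Longrightarrow> C \<in> carrier_mat k l
    \<Longrightarrow> g \<in> parabolic k l"
  unfolding parabolic_def mem_Collect_eq
  by (rule exI[of _ A], rule exI[of _ B], rule exI[of _ C]) (intro conjI)

text \<open>Columns are the images of the variables, so the vanishing of the last row expresses that
  the span of the first \<open>m\<close> variables is preserved. All later arguments use this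
  description instead of blocks.\<close>

lemma parabolic_iff:
  "g \<in> parabolic m (Suc 0) \<longleftrightarrow> g \<in> GL (Suc m) \<and> (\<forall>j<m. g $$ (m, j) = 0)"
proof
  assume "g \<in> parabolic m (Suc 0)"
  then obtain A C B where g: "g = four_block_mat A C (0\<^sub>m 1 m) B"
    and A: "A \<in> GL m" and B: "B \<in> GL 1" and C: "C \<in> carrier_mat m 1"
    by (auto simp: parabolic_def)
  note car = GL_carrier[OF A] GL_carrier[OF B]
  have "g \<in> carrier_mat (m + 1) (m + 1)" unfolding g using car by (intro four_block_carrier_mat)
  moreover have "det g = det A * det B"
    unfolding g using car C by (intro det_four_block_mat_lower_left_zero) auto
  ultimately show "g \<in> GL (Suc m) \<and> (\<forall>j<m. g $$ (m, j) = 0)"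
    using A B car by (auto simp: GL_iff_det g)
next
  assume g: "g \<in> GL (Suc m) \<and> (\<forall>j<m. g $$ (m, j) = 0)"
  define A where "A = mat m m (\<lambda>(i, j). g $$ (i, j))"
  define C where "C = mat m 1 (\<lambda>(i, j). g $$ (i, m))"
  define B where "B = mat 1 1 (\<lambda>(i, j). g $$ (m, m))"
  have gb: "g = four_block_mat A C (0\<^sub>m 1 m) B"
    using g GL_carrier[of g "Suc m"]
    by (intro eq_matI) (auto simp: A_def B_def C_def less_Suc_eq)
  have car: "A \<in> carrier_mat m m" "B \<in> carrier_mat 1 1" "C \<in> carrier_mat m 1"
    by (simp_all add: A_def B_def C_def)
  have "det g = det A * det B"
    by (subst gb, rule det_four_block_mat_lower_left_zero) (use car in simp_all)
  moreover have "det g \<noteq> 0" using g by (simp add: GL_iff_det)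
  ultimately have "A \<in> GL m" "B \<in> GL 1" using car by (simp_all add: GL_iff_det)
  then have "g \<in> parabolic m 1" using car(3) by (rule parabolicI[OF gb])
  then show "g \<in> parabolic m (Suc 0)" by (simp only: One_nat_def)
qed

lemma parabolic_inverse:
  assumes "g \<in> parabolic m (Suc 0)" "h \<in> carrier_mat (Suc m) (Suc m)" "g * h = 1\<^sub>m (Suc m)" "h * g = 1\<^sub>m (Suc m)"
  shows "h \<in> parabolic m (Suc 0)"
proof -
  have g: "g \<in> GL (Suc m)" "\<And>j. j < m \<Longrightarrow> g $$ (m, j) = 0"
    using assms(1) by (auto simp: parabolic_iff)
  have "(1\<^sub>m (Suc m)) $$ (m, j) = g $$ (m, m) * h $$ (m, j)" if "j \<le> m" for j
    using that assms index_mult_mat_sum[OF GL_carrier[OF g(1)] assms(2), of m j] g(2) by auto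
  note row = this
  have "h $$ (m, j) = 0" if "j < m" for j
    using that row[of j] row[of m] by auto
  then show ?thesis using assms GL_I GL_carrier[OF g(1)] by (auto simp: parabolic_iff)
qed

lemma one_in_parabolic: "1\<^sub>m (Suc m) \<in> parabolic m (Suc 0)"
  by (simp add: parabolic_iff one_in_GL)

lemma parabolic_subset_GL: "parabolic m (Suc 0) \<subseteq> GL (Suc m)"
  by (auto simp: parabolic_iff)

lemma act_additive_poly:
  "act n g (additive_poly a k x) = additive_poly (\<lambda>i. act n g (a i)) k (act n g x)"
  by (simp add: additive_poly_def act.hom_sum act.hom_mult act.hom_power)

lemma span_coeff_unique:
  fixes a :: "nat \<Rightarrow> 'p::prime_card fpoly"
  assumes "a m = 1" "\<And>j. j < m \<Longrightarrow> additive_poly a m (Y j) = 0" "i \<le> m"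
  shows "a i = span_coeff m i"
proof (cases "i = m")
  case False
  then obtain k where k: "m = Suc k" using assms(3) by (cases m) auto
  define b where "b = (\<lambda>i. a i - span_coeff m i)"
  have "additive_poly b k (Y j) = 0" if "j \<le> k" for j
  proof -
    have j: "j < m" using that k by simp
    have "additive_poly b k (Y j) = additive_poly b m (Y j)"
      using assms(1) by (simp add: additive_poly_def b_def k)
    also have "\<dots> = additive_poly a m (Y j) - span_poly m (Y j)"
      by (simp add: b_def additive_poly_def span_poly_def sum_subtractf left_diff_distrib)
    finally show ?thesis using assms(2)[OF j] span_poly_Y[OF j] by simp
  qed
  then have "b i = 0" by (rule additive_poly_unique[of k]) (use assms False k in simp_all)
  then show ?thesis by (simp add: b_def)
qed (simp add: assms)

lemma span_poly_lin_form: "span_poly m (lin_form m v) = (0 :: 'p::prime_card fpoly)"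
  unfolding span_poly_def additive_poly_lin_form by (simp add: span_poly_Y flip: span_poly_def)

lemma span_poly_lin_form_Suc:
  "span_poly m (lin_form (Suc m) v) = Const (v m) * (span_poly m (Y m) :: 'p::prime_card fpoly)"
  using span_poly_lin_form[of m v]
  unfolding span_poly_def additive_poly_lin_form by simp

text \<open>An automorphism whose inverse preserves the span of the first \<open>m\<close> variables fixes their
  additive polynomial, since the latter is determined by its roots.\<close>

lemma act_span_coeff:
  fixes g :: "'p::prime_card mod_ring mat"
  assumes "\<And>j. j < m \<Longrightarrow> \<exists>v. Y j = act n g (lin_form m v)" "i \<le> m"
  shows "act n g (span_coeff m i) = span_coeff m i"
proof (rule span_coeff_unique[OF _ _ assms(2)])
  fix j assume "j < m"
  then obtain v where v: "Y j = act n g (lin_form m v)" using assms(1) by blast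
  have "act n g (span_poly m (lin_form m v)) = 0" by (simp add: span_poly_lin_form)
  then show "additive_poly (\<lambda>i. act n g (span_coeff m i)) m (Y j) = 0"
    by (simp add: span_poly_def act_additive_poly v)
qed simp

lemma act_span_coeff_GL:
  assumes g: "g \<in> GL n" and i: "i \<le> n"
  shows "act n g (span_coeff n i) = (span_coeff n i :: 'p::prime_card fpoly)"
proof (rule act_span_coeff[OF _ i])
  fix j assume j: "j < n"
  obtain h where h: "h \<in> GL n" "g * h = 1\<^sub>m n" using GL_inverse[OF g] by metis
  have "act n g (act n h (Y j)) = Y j"
    using j by (simp add: act_act GL_carrier g h act_one_Y)
  then have "Y j = act n g (lin_form n (\<lambda>i. h $$ (i, j)))" using j by (simp add: act_Y)
  then show "\<exists>v. Y j = act n g (lin_form n v)" by (intro exI[of _ "\<lambda>i. h $$ (i, j)"])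
qed

lemma lin_form_Suc_eq: "v m = 0 \<Longrightarrow> lin_form (Suc m) v = lin_form m v"
  by (simp add: lin_form_def)

lemma act_span_coeff_parabolic:
  assumes g: "g \<in> parabolic m (Suc 0)" and i: "i \<le> m"
  shows "act (Suc m) g (span_coeff m i) = (span_coeff m i :: 'p::prime_card fpoly)"
proof (rule act_span_coeff[OF _ i])
  fix j assume j: "j < m"
  have gl: "g \<in> GL (Suc m)" using g by (simp add: parabolic_iff)
  then obtain h where h: "h \<in> GL (Suc m)" "g * h = 1\<^sub>m (Suc m)" "h * g = 1\<^sub>m (Suc m)"
    by (rule GL_inverse)
  have "h \<in> parabolic m (Suc 0)" by (rule parabolic_inverse[OF g GL_carrier h(2,3)]) (rule h)
  then have "lin_form (Suc m) (\<lambda>i. h $$ (i, j)) = lin_form m (\<lambda>i. h $$ (i, j))"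
    using j by (intro lin_form_Suc_eq) (simp add: parabolic_iff)
  moreover have "act (Suc m) g (act (Suc m) h (Y j)) = Y j"
    using j by (simp add: act_act GL_carrier gl h act_one_Y)
  ultimately have "Y j = act (Suc m) g (lin_form m (\<lambda>i. h $$ (i, j)))"
    using j by (simp add: act_Y)
  then show "\<exists>v. Y j = act (Suc m) g (lin_form m v)" by (intro exI[of _ "\<lambda>i. h $$ (i, j)"])
qed

abbreviation "sym_invs m \<equiv> invariants (Suc m) (GL (Suc m))"
abbreviation "par_invs m \<equiv> invariants (Suc m) (parabolic m (Suc 0))"

lemmas sym_invs_def = invariants_altdef[OF one_in_GL]
lemmas par_invs_def = invariants_altdef[OF one_in_parabolic]

lemma sym_invs_subset: "sym_invs m \<subseteq> par_invs m"
  using parabolic_subset_GL by (auto simp: sym_invs_def par_invs_def)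

lemma invariants_ring:
  assumes "1\<^sub>m n \<in> H"
  shows invariants_Const: "Const c \<in> invariants n H"
    and invariants_0: "0 \<in> invariants n H"
    and invariants_1: "1 \<in> invariants n H"
    and invariants_add: "f \<in> invariants n H \<Longrightarrow> g \<in> invariants n H \<Longrightarrow> f + g \<in> invariants n H"
    and invariants_diff: "f \<in> invariants n H \<Longrightarrow> g \<in> invariants n H \<Longrightarrow> f - g \<in> invariants n H"
    and invariants_uminus: "f \<in> invariants n H \<Longrightarrow> - f \<in> invariants n H"
    and invariants_mult: "f \<in> invariants n H \<Longrightarrow> g \<in> invariants n H \<Longrightarrow> f * g \<in> invariants n H"
    and invariants_power: "f \<in> invariants n H \<Longrightarrow> f ^ k \<in> invariants n H"
    and invariants_sum: "(\<And>x. x \<in> A \<Longrightarrow> F x \<in> invariants n H) \<Longrightarrow> sum F A \<in> invariants n H"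
  using assms
  by (auto simp: invariants_altdef act.hom_add act.hom_mult act.hom_minus act.hom_uminus
      act.hom_power act.hom_sum)

lemmas sym_invs_ring = invariants_ring[OF one_in_GL]
lemmas par_invs_ring = invariants_ring[OF one_in_parabolic]

lemma dickson_in_sym_invs:
  assumes "i \<le> Suc m" shows "dickson (Suc m) i \<in> sym_invs m"
  unfolding dickson_eq[OF assms]
  by (intro sym_invs_ring) (use assms in \<open>auto simp: sym_invs_def act_span_coeff_GL\<close>)

lemma dickson_in_par_invs:
  assumes "i \<le> m" shows "dickson m i \<in> par_invs m"
  unfolding dickson_eq[OF assms]
  by (intro par_invs_ring) (use assms in \<open>auto simp: par_invs_def act_span_coeff_parabolic\<close>)

text \<open>In the recursion for \<open>dickson (Suc m) m\<close> the factor next to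
  \<open>top_class m\<close> is \<open>dickson m m = 1\<close>, which isolates the top
  class.\<close>

lemma top_class_in_par_invs:
  assumes "m \<ge> 1" shows "(top_class m :: 'p::prime_card fpoly) \<in> par_invs m"
proof -
  obtain k where k: "m = Suc k" using assms by (cases m) auto
  have "top_class m = dickson (Suc m) m - (dickson m k ^ CARD('p) :: 'p fpoly)"
    using k by (simp add: dickson_Suc_Suc)
  then show ?thesis
    using dickson_in_sym_invs[of m m] sym_invs_subset[of m] dickson_in_par_invs[of k m] k
    by (auto intro!: par_invs_ring)
qed

text \<open>The recursion recovers every \<open>dickson m i\<close> from the top class and the
  Dickson algebra, so a matrix fixing the top class fixes \<open>span_poly m\<close> and permutes
  its roots. Consequently different cosets give different conjugates of the top class.\<close>

lemma act_top_class_eq_imp: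
  fixes g :: "'p::prime_card mod_ring mat"
  assumes g: "g \<in> GL (Suc m)" and top: "act (Suc m) g (top_class m) = top_class m"
  shows "g \<in> parabolic m (Suc 0)"
proof -
  let ?a = "act (Suc m) g"
  have D: "?a (dickson (Suc m) i) = dickson (Suc m) i" if "i \<le> Suc m" for i
    using dickson_in_sym_invs[OF that] g by (auto simp: sym_invs_def)
  have d: "?a (dickson m i) = dickson m i" if "i \<le> m" for i
    using that
  proof (induction i)
    case 0
    have "top_class m * ?a (dickson m 0) = top_class m * dickson m 0"
      using D[of 0] top by (simp add: dickson_Suc_0 act.hom_mult)
    then show ?case by (simp add: top_class_nonzero)
  next
    case (Suc i)
    have "top_class m * ?a (dickson m (Suc i)) = top_class m * dickson m (Suc i)"
      using D[of "Suc i"] Suc top by (simp add: dickson_Suc_Suc act.hom_mult act.hom_add act.hom_power)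
    then show ?case by (simp add: top_class_nonzero)
  qed
  have c: "?a (span_coeff m i) = span_coeff m i" if "i \<le> m" for i
    using d[OF that] by (simp add: dickson_eq[OF that] act.hom_mult act.hom_power act.hom_uminus)
  \<comment> \<open>The image of the root \<open>Y j\<close> is again a root of the same polynomial,
    but its value there is \<open>g $$ (m, j)\<close> times the nonzero
    \<open>span_poly m (Y m)\<close>.\<close>
  have "g $$ (m, j) = 0" if j: "j < m" for j
  proof -
    have "0 = ?a (span_poly m (Y j))" using j by (simp add: span_poly_Y)
    also have "\<dots> = span_poly m (?a (Y j))"
      unfolding span_poly_def act_additive_poly by (simp add: additive_poly_def c)
    also have "\<dots> = Const (g $$ (m, j)) * span_poly m (Y m)"
      using j by (simp add: act_Y span_poly_lin_form_Suc)
    finally show ?thesis by (simp add: span_poly_Y_nonzero)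
  qed
  then show ?thesis using g by (simp add: parabolic_iff)
qed

subsection \<open>Cosets of the parabolic group and normalized linear functionals\<close>

lemma GL_with_row:
  assumes a: "a < n" and k: "k < n" "v k \<noteq> 0"
  obtains h where "h \<in> GL n" "\<And>j. j < n \<Longrightarrow> h $$ (a, j) = (v j :: 'p::prime_card mod_ring)"
proof -
  \<comment> \<open>Every row other than \<open>a\<close> is a unit vector, its own one except that
    row \<open>k\<close> takes the one at \<open>a\<close>. Thus column \<open>k\<close> is zero
    outside row \<open>a\<close>, where it carries the nonzero \<open>v k\<close>.\<close>
  define h where "h = mat n n (\<lambda>(i, j). if i = a then v j
      else if j = (if i = k then a else i) then 1 else 0)"
  have hc: "h \<in> carrier_mat n n" by (simp add: h_def)
  have "x = 0\<^sub>v n" if x: "x \<in> carrier_vec n" "h *\<^sub>v x = 0\<^sub>v n" for x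
  proof -
    have row: "(\<Sum>j<n. h $$ (i, j) * x $ j) = 0" if "i < n" for i
    proof -
      have "(h *\<^sub>v x) $ i = (\<Sum>j<n. h $$ (i, j) * x $ j)"
        using that hc x(1) by (auto simp: scalar_prod_def lessThan_atLeast0)
      then show ?thesis using x(2) that by simp
    qed
    have x0: "x $ j = 0" if j: "j < n" "j \<noteq> k" for j
    proof -
      define i where "i = (if j = a then k else j)"
      have i: "i < n" "i \<noteq> a" "(if i = k then a else i) = j" using j k by (auto simp: i_def)
      have "(\<Sum>j'<n. h $$ (i, j') * x $ j') = (\<Sum>j'<n. if j' = j then x $ j else 0)"
        using i by (intro sum.cong) (auto simp: h_def)
      then show ?thesis using row[OF i(1)] j by simp
    qed
    have "(\<Sum>j<n. h $$ (a, j) * x $ j) = (\<Sum>j<n. if j = k then v k * x $ k else 0)"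
      using a x0 by (intro sum.cong) (auto simp: h_def)
    then have "x $ k = 0" using row[OF a] k by simp
    then show ?thesis using x0 x by (intro eq_vecI) auto
  qed
  then have "det h \<noteq> 0" using det_0_iff_vec_prod_zero[OF hc] by blast
  then have "h \<in> GL n" using hc by (simp add: GL_iff_det)
  then show ?thesis using that a by (auto simp: h_def)
qed

lemma GL_with_col:
  assumes a: "a < n" and k: "k < n" "v k \<noteq> 0"
  obtains h where "h \<in> GL n" "\<And>j. j < n \<Longrightarrow> h $$ (j, a) = (v j :: 'p::prime_card mod_ring)"
proof -
  obtain h where h: "h \<in> GL n" "\<And>j. j < n \<Longrightarrow> h $$ (a, j) = v j"
    using GL_with_row[where v = v, OF assms] by metis
  have "transpose_mat h \<in> GL n" using h(1) by (auto simp: GL_iff_det det_transpose)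
  moreover have "transpose_mat h $$ (j, a) = v j" if "j < n" for j
    using that a h GL_carrier[OF h(1)] by simp
  ultimately show ?thesis using that by blast
qed

text \<open>\<open>g\<close> maps the hyperplane of the first \<open>m\<close> variables to the kernel of \<open>l\<close>.\<close>

definition kernel_of :: "nat \<Rightarrow> (nat \<Rightarrow> 'p mod_ring) \<Rightarrow> 'p::prime_card mod_ring mat \<Rightarrow> bool" where
  "kernel_of m l g \<longleftrightarrow> (\<forall>j<m. (\<Sum>i\<le>m. l i * g $$ (i, j)) = 0)"

text \<open>Representatives of the points of the dual projective space: the first nonzero coordinate
  is 1 and stands at position \<open>k\<close>. \<open>PiE\<close> fixes the values beyond
  \<open>m\<close>, so a hyperplane has exactly one representative.\<close>

definition functionals :: "nat \<Rightarrow> nat \<Rightarrow> (nat \<Rightarrow> 'p::prime_card mod_ring) set" where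
  "functionals m k = PiE {..m} (\<lambda>i. if i < k then {0} else if i = k then {1} else UNIV)"

definition norm_functionals :: "nat \<Rightarrow> (nat \<Rightarrow> 'p::prime_card mod_ring) set" where
  "norm_functionals m = (\<Union>k\<le>m. functionals m k)"

lemma functionals_lead:
  assumes "l \<in> functionals m k" "k \<le> m"
  shows "l k = 1" "\<And>i. i < k \<Longrightarrow> l i = 0"
proof -
  show "l k = 1" using PiE_mem[OF assms(1)[unfolded functionals_def], of k] assms by auto
  show "l i = 0" if "i < k" for i
    using PiE_mem[OF assms(1)[unfolded functionals_def], of i] that assms by auto
qed

lemma finite_functionals: "finite (functionals m k)"
  unfolding functionals_def by (rule finite_PiE) auto

lemma card_functionals:
  assumes "k \<le> m"
  shows "card (functionals m k :: (nat \<Rightarrow> 'p::prime_card mod_ring) set) = CARD('p) ^ (m - k)"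
proof -
  have "card (functionals m k :: (nat \<Rightarrow> 'p mod_ring) set) =
      (\<Prod>i\<le>m. card (if i < k then {0} else if i = k then {1} else UNIV :: 'p mod_ring set))"
    unfolding functionals_def by (rule card_PiE) simp
  also have "\<dots> = (\<Prod>i\<le>m. if i \<in> {k<..m} then CARD('p) else 1)"
    by (intro prod.cong) auto
  also have "\<dots> = (\<Prod>i\<in>{..m} \<inter> {k<..m}. CARD('p))"
    by (simp only: prod.inter_restrict finite_atMost)
  also have "{..m} \<inter> {k<..m} = {k<..m}" by auto
  finally show ?thesis by simp
qed

lemma functionals_disjoint:
  assumes "j \<le> m" "k \<le> m" "j \<noteq> k"
  shows "functionals m j \<inter> functionals m k = ({} :: (nat \<Rightarrow> 'p::prime_card mod_ring) set)"
proof -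
  have "\<not> (l \<in> functionals m j \<and> l \<in> functionals m k)" if "j \<le> m" "k \<le> m" "j < k"
    for j k and l :: "nat \<Rightarrow> 'p mod_ring"
    using functionals_lead[of l m j] functionals_lead[of l m k] that by auto
  then show ?thesis using assms by (metis disjoint_iff nat_neq_iff)
qed

definition repunit :: "nat \<Rightarrow> nat \<Rightarrow> nat" where
  "repunit p k = (\<Sum>i<k. p ^ i)"

lemma card_norm_functionals:
  "card (norm_functionals m :: (nat \<Rightarrow> 'p::prime_card mod_ring) set) = repunit CARD('p) (Suc m)"
proof -
  have "card (norm_functionals m :: (nat \<Rightarrow> 'p mod_ring) set) =
      (\<Sum>k\<le>m. card (functionals m k :: (nat \<Rightarrow> 'p mod_ring) set))"
    unfolding norm_functionals_def
    by (intro card_UN_disjoint) (auto simp: finite_functionals functionals_disjoint)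
  also have "\<dots> = (\<Sum>k\<le>m. CARD('p) ^ (m - k))" by (simp add: card_functionals)
  also have "\<dots> = (\<Sum>k\<le>m. CARD('p) ^ k)"
    by (intro sum.reindex_bij_witness[of _ "\<lambda>k. m - k" "\<lambda>k. m - k"]) auto
  finally show ?thesis by (simp add: repunit_def lessThan_Suc_atMost)
qed

lemma finite_norm_functionals: "finite (norm_functionals m)"
  by (simp add: norm_functionals_def finite_functionals)

text \<open>Complete \<open>l\<close> to an invertible matrix with last row \<open>l\<close>; the
  first \<open>m\<close> columns of the inverse then lie in the kernel of \<open>l\<close>.\<close>

lemma kernel_of_exists:
  assumes "l \<in> norm_functionals m"
  obtains g where "g \<in> GL (Suc m)" "kernel_of m l g"
proof -
  obtain k where k: "k \<le> m" "l \<in> functionals m k" using assms by (auto simp: norm_functionals_def)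
  then have "l k \<noteq> 0" using functionals_lead by (metis zero_neq_one)
  then obtain h where h: "h \<in> GL (Suc m)" "\<And>j. j < Suc m \<Longrightarrow> h $$ (m, j) = l j"
    using GL_with_row[of m "Suc m" k l] k by auto
  obtain g where g: "g \<in> GL (Suc m)" "h * g = 1\<^sub>m (Suc m)" using GL_inverse[OF h(1)] by metis
  have "(\<Sum>i\<le>m. l i * g $$ (i, j)) = 0" if "j < m" for j
  proof -
    have "(\<Sum>i\<le>m. l i * g $$ (i, j)) = (\<Sum>i<Suc m. h $$ (m, i) * g $$ (i, j))"
      unfolding lessThan_Suc_atMost by (intro sum.cong) (auto simp: h)
    also have "\<dots> = (h * g) $$ (m, j)"
      using that by (subst index_mult_mat_sum[OF GL_carrier[OF h(1)] GL_carrier[OF g(1)]]) auto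
    finally show ?thesis using g that by simp
  qed
  then show ?thesis using that g by (auto simp: kernel_of_def)
qed

text \<open>The functionals with a given kernel are the multiples of the last row of \<open>g\<inverse>\<close>.\<close>

lemma kernel_of_proportional:
  assumes g: "g \<in> GL (Suc m)" and h: "h \<in> GL (Suc m)" "g * h = 1\<^sub>m (Suc m)"
    and l: "kernel_of m l g" and j: "j \<le> m"
  shows "l j = (\<Sum>i\<le>m. l i * g $$ (i, m)) * h $$ (m, j)"
proof -
  have "(\<Sum>k\<le>m. (\<Sum>i\<le>m. l i * g $$ (i, k)) * h $$ (k, j)) =
      (\<Sum>i\<le>m. l i * (\<Sum>k<Suc m. g $$ (i, k) * h $$ (k, j)))"
    by (simp only: sum_distrib_left sum_distrib_right lessThan_Suc_atMost mult.assoc)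
       (rule sum.swap)
  also have "\<dots> = (\<Sum>i\<le>m. l i * (if i = j then 1 else 0))"
  proof (intro sum.cong refl)
    fix i assume "i \<in> {..m}"
    then have "(\<Sum>k<Suc m. g $$ (i, k) * h $$ (k, j)) = (g * h) $$ (i, j)"
      using j by (subst index_mult_mat_sum[OF GL_carrier[OF g] GL_carrier[OF h(1)]]) auto
    then show "l i * (\<Sum>k<Suc m. g $$ (i, k) * h $$ (k, j)) = l i * (if i = j then 1 else 0)"
      using j \<open>i \<in> {..m}\<close> by (simp add: h(2) del: sum.lessThan_Suc)
  qed
  also have "\<dots> = l j" using j by (simp add: if_distrib cong: if_cong)
  finally have "l j = (\<Sum>k\<le>m. (\<Sum>i\<le>m. l i * g $$ (i, k)) * h $$ (k, j))" ..
  also have "\<dots> = (\<Sum>k\<in>{m}. (\<Sum>i\<le>m. l i * g $$ (i, k)) * h $$ (k, j))"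
    using l by (intro sum.mono_neutral_right) (auto simp: kernel_of_def)
  finally show ?thesis by simp
qed

text \<open>Both functionals are multiples of the last row of the inverse of \<open>g\<close>, and
  normalization of the leading coordinate leaves one multiple only.\<close>

lemma kernel_of_unique:
  assumes g: "g \<in> GL (Suc m)"
    and l: "l \<in> norm_functionals m" "kernel_of m l g"
    and l': "l' \<in> norm_functionals m" "kernel_of m l' g"
  shows "l = (l' :: nat \<Rightarrow> 'p::prime_card mod_ring)"
proof -
  obtain h where h: "h \<in> GL (Suc m)" "g * h = 1\<^sub>m (Suc m)" using GL_inverse[OF g] by metis
  obtain k k' where k: "k \<le> m" "l \<in> functionals m k" and k': "k' \<le> m" "l' \<in> functionals m k'"
    using l l' by (auto simp: norm_functionals_def)
  define r where "r = (\<lambda>j. h $$ (m, j))"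
  define a where "a = (\<Sum>i\<le>m. l i * g $$ (i, m))"
  define b where "b = (\<Sum>i\<le>m. l' i * g $$ (i, m))"
  have L: "l j = a * r j" and L': "l' j = b * r j" if "j \<le> m" for j
    using kernel_of_proportional[OF g h l(2) that] kernel_of_proportional[OF g h l'(2) that]
    by (simp_all add: a_def b_def r_def)
  have a: "a \<noteq> 0" "r k \<noteq> 0" using L[OF k(1)] functionals_lead(1)[OF k(2,1)] by auto
  have b: "b \<noteq> 0" "r k' \<noteq> 0" using L'[OF k'(1)] functionals_lead(1)[OF k'(2,1)] by auto
  have "\<not> k < k'" using functionals_lead(2)[OF k'(2,1)] L'[OF k(1)] a b by auto
  moreover have "\<not> k' < k" using functionals_lead(2)[OF k(2,1)] L[OF k'(1)] a b by auto
  ultimately have "k = k'" by simp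
  then have "a * r k = b * r k"
    using functionals_lead(1)[OF k(2,1)] functionals_lead(1)[OF k'(2,1)] L[OF k(1)] L'[OF k(1)] by metis
  then have "a = b" using a by simp
  then have "l j = l' j" for j
    using k k' L[of j] L'[of j] unfolding functionals_def
    by (cases "j \<le> m") (auto simp: PiE_def extensional_def)
  then show ?thesis ..
qed

lemma kernel_of_functional_exists:
  assumes g: "g \<in> GL (Suc m)"
  obtains l where "l \<in> norm_functionals m" "kernel_of m l (g :: 'p::prime_card mod_ring mat)"
proof -
  obtain h where h: "h \<in> GL (Suc m)" "h * g = 1\<^sub>m (Suc m)" using GL_inverse[OF g] by metis
  have prod: "(\<Sum>i\<le>m. h $$ (m, i) * g $$ (i, j)) = (if j = m then 1 else 0)" if "j \<le> m" for j
    using that h index_mult_mat_sum[OF GL_carrier[OF h(1)] GL_carrier[OF g], of m j]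
    by (auto simp: lessThan_Suc_atMost)
  have "\<exists>i\<le>m. h $$ (m, i) \<noteq> 0"
  proof (rule ccontr)
    assume "\<not> ?thesis"
    then have "(\<Sum>i\<le>m. h $$ (m, i) * g $$ (i, m)) = 0" by simp
    then show False using prod[of m] by simp
  qed
  define k where "k = (LEAST i. h $$ (m, i) \<noteq> 0)"
  have k: "k \<le> m" "h $$ (m, k) \<noteq> 0"
    using \<open>\<exists>i\<le>m. h $$ (m, i) \<noteq> 0\<close> unfolding k_def by (metis (mono_tags, lifting) LeastI_ex Least_le le_trans)+
  have kz: "h $$ (m, i) = 0" if "i < k" for i
    using not_less_Least[OF that[unfolded k_def]] by simp
  define l where "l = restrict (\<lambda>i. h $$ (m, i) / h $$ (m, k)) {..m}"
  have "l \<in> functionals m k"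
    using k kz unfolding functionals_def by (auto simp: l_def)
  then have "l \<in> norm_functionals m" using k by (auto simp: norm_functionals_def)
  moreover have "kernel_of m l g"
    using prod by (simp add: kernel_of_def l_def flip: sum_divide_distrib)
  ultimately show ?thesis using that by blast
qed

text \<open>The functional \<open>a\<close>, that is \<open>l\<close> composed with
  \<open>g\<close>, is a nonzero multiple of the last coordinate. The kernel condition for
  \<open>g * k\<close> therefore says that the last row of \<open>k\<close> vanishes before the
  diagonal.\<close>

lemma kernel_of_same_coset:
  assumes g: "g \<in> GL (Suc m)" and k: "k \<in> GL (Suc m)" and l: "l \<in> norm_functionals m"
    and ker: "kernel_of m l g" "kernel_of m l (g * k)"
  shows "(k :: 'p::prime_card mod_ring mat) \<in> parabolic m (Suc 0)"
proof -
  define a where "a = (\<lambda>j. \<Sum>i\<le>m. l i * g $$ (i, j))"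
  have az: "a j = 0" if "j < m" for j using ker(1) that by (simp add: a_def kernel_of_def)
  obtain h where h: "h \<in> GL (Suc m)" "g * h = 1\<^sub>m (Suc m)" using GL_inverse[OF g] by metis
  obtain j where j: "j \<le> m" "l \<in> functionals m j" using l by (auto simp: norm_functionals_def)
  then have "l j \<noteq> 0" using functionals_lead(1)[OF j(2,1)] by simp
  then have am: "a m \<noteq> 0" using kernel_of_proportional[OF g h ker(1) j(1)] by (auto simp: a_def)
  have "k $$ (m, j) = 0" if j: "j < m" for j
  proof -
    have "0 = (\<Sum>i\<le>m. l i * (g * k) $$ (i, j))" using ker(2) j by (simp add: kernel_of_def)
    also have "\<dots> = (\<Sum>i\<le>m. \<Sum>r\<le>m. l i * (g $$ (i, r) * k $$ (r, j)))"
      using j by (intro sum.cong refl)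
        (simp add: index_mult_mat_sum[OF GL_carrier[OF g] GL_carrier[OF k]] lessThan_Suc_atMost
          sum_distrib_left del: sum.lessThan_Suc)
    also have "\<dots> = (\<Sum>r\<le>m. a r * k $$ (r, j))"
      unfolding a_def sum_distrib_right mult.assoc by (rule sum.swap)
    also have "\<dots> = (\<Sum>r\<in>{m}. a r * k $$ (r, j))"
      by (intro sum.mono_neutral_right) (auto simp: az)
    finally show ?thesis using am by simp
  qed
  then show ?thesis using k by (simp add: parabolic_iff)
qed

lemma kernel_of_parabolic:
  assumes g: "g \<in> GL (Suc m)" and k: "k \<in> parabolic m (Suc 0)" and ker: "kernel_of m l (g * k)"
  shows "kernel_of m (l :: nat \<Rightarrow> 'p::prime_card mod_ring) g"
proof -
  have kG: "k \<in> GL (Suc m)" using k by (simp add: parabolic_iff)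
  obtain h where h: "h \<in> GL (Suc m)" "k * h = 1\<^sub>m (Suc m)" "h * k = 1\<^sub>m (Suc m)"
    using GL_inverse[OF kG] by metis
  have hp: "h \<in> parabolic m (Suc 0)" by (rule parabolic_inverse[OF k GL_carrier[OF h(1)] h(2,3)])
  have gkh: "g = g * k * h"
    using GL_carrier[OF g] h(2)
    by (simp add: assoc_mult_mat[OF GL_carrier[OF g] GL_carrier[OF kG] GL_carrier[OF h(1)]])
  have "(\<Sum>i\<le>m. l i * g $$ (i, j)) = 0" if j: "j < m" for j
  proof -
    have "(\<Sum>i\<le>m. l i * (g * k * h) $$ (i, j)) =
        (\<Sum>i\<le>m. \<Sum>r\<le>m. l i * ((g * k) $$ (i, r) * h $$ (r, j)))"
      using j by (intro sum.cong refl)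
        (simp add: index_mult_mat_sum[OF GL_carrier[OF GL_mult[OF g kG]] GL_carrier[OF h(1)]]
          lessThan_Suc_atMost sum_distrib_left del: sum.lessThan_Suc)
    also have "\<dots> = (\<Sum>r\<le>m. (\<Sum>i\<le>m. l i * (g * k) $$ (i, r)) * h $$ (r, j))"
      unfolding sum_distrib_right mult.assoc by (rule sum.swap)
    also have "\<dots> = 0"
      using ker hp j by (intro sum.neutral) (auto simp: kernel_of_def parabolic_iff le_less)
    finally show ?thesis using gkh by simp
  qed
  then show ?thesis by (simp add: kernel_of_def)
qed

text \<open>A coset is determined by the hyperplane onto which it carries the span of the first
  \<open>m\<close> unit vectors. Sums over an arbitrary system \<open>R\<close> become sums over one
  fixed index set, and the number of cosets can be counted.\<close>

lemma coset_reps_bij: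
  fixes R :: "'p::prime_card mod_ring mat set"
  assumes R: "left_coset_reps R (GL (Suc m)) (parabolic m (Suc 0))"
  obtains f where "bij_betw f R (norm_functionals m)"
    "\<And>r. r \<in> R \<Longrightarrow> kernel_of m (f r) r"
proof -
  have RG: "R \<subseteq> GL (Suc m)"
    and rep: "\<And>g. g \<in> GL (Suc m) \<Longrightarrow> \<exists>!r. r \<in> R \<and> (\<exists>h\<in>parabolic m (Suc 0). g = r * h)"
    using R by (auto simp: left_coset_reps_def)
  have "\<forall>r\<in>R. \<exists>l. l \<in> norm_functionals m \<and> kernel_of m l r"
    using RG kernel_of_functional_exists by (metis subsetD)
  then obtain f where f: "\<And>r. r \<in> R \<Longrightarrow> f r \<in> norm_functionals m" "\<And>r. r \<in> R \<Longrightarrow> kernel_of m (f r) r"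
    by metis
  have "bij_betw f R (norm_functionals m)"
    unfolding bij_betw_def
  proof (intro conjI inj_onI equalityI subsetI)
    fix r s assume rs: "r \<in> R" "s \<in> R" "f r = f s"
    have r: "r \<in> GL (Suc m)" and s: "s \<in> GL (Suc m)" using rs RG by auto
    obtain h where h: "h \<in> GL (Suc m)" "r * h = 1\<^sub>m (Suc m)" using GL_inverse[OF r] by metis
    have eq: "s = r * (h * s)"
      using h(2) GL_carrier[OF s] by (simp flip: assoc_mult_mat[OF GL_carrier[OF r] GL_carrier[OF h(1)] GL_carrier[OF s]])
    have "h * s \<in> parabolic m (Suc 0)"
      by (rule kernel_of_same_coset[OF r GL_mult[OF h(1) s] f(1)[OF rs(1)] f(2)[OF rs(1)]])
         (use f(2)[OF rs(2)] rs(3) eq in simp)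
    moreover have "s = s * 1\<^sub>m (Suc m)" using GL_carrier[OF s] by simp
    ultimately show "r = s" using rep[OF s] rs eq one_in_parabolic by metis
  next
    fix l :: "nat \<Rightarrow> 'p mod_ring" assume l: "l \<in> norm_functionals m"
    then obtain g where g: "g \<in> GL (Suc m)" "kernel_of m l g" by (rule kernel_of_exists)
    then obtain r h where r: "r \<in> R" "h \<in> parabolic m (Suc 0)" "g = r * h" using rep by blast
    then have "kernel_of m l r" using g RG kernel_of_parabolic by blast
    then have "l = f r" using kernel_of_unique l f r RG by blast
    then show "l \<in> f ` R" using r by blast
  qed (use f in auto)
  then show ?thesis using that f by blast
qed

subsection \<open>The transfer as a sum over functionals\<close>

text \<open>\<open>SOME\<close> picks an arbitrary matrix of the coset belonging to
  \<open>l\<close>; for parabolic invariants \<open>x\<close> the value does not depend on the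
  choice, by \<open>coset_value_eq\<close>.\<close>

definition coset_value :: "nat \<Rightarrow> 'p fpoly \<Rightarrow> (nat \<Rightarrow> 'p mod_ring) \<Rightarrow> 'p::prime_card fpoly" where
  "coset_value m x l = act (Suc m) (SOME g. g \<in> GL (Suc m) \<and> kernel_of m l g) x"

lemma coset_value_eq:
  assumes x: "x \<in> par_invs m" and l: "l \<in> norm_functionals m"
    and g: "g \<in> GL (Suc m)" "kernel_of m l g"
  shows "coset_value m x l = act (Suc m) g (x :: 'p::prime_card fpoly)"
proof -
  define h where "h = (SOME g. g \<in> GL (Suc m) \<and> kernel_of m l g)"
  have h: "h \<in> GL (Suc m)" "kernel_of m l h"
    using someI[of "\<lambda>g. g \<in> GL (Suc m) \<and> kernel_of m l g" g] g by (auto simp: h_def)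
  obtain i where i: "i \<in> GL (Suc m)" "g * i = 1\<^sub>m (Suc m)" using GL_inverse[OF g(1)] by metis
  have eq: "h = g * (i * h)"
    using i(2) GL_carrier[OF h(1)]
    by (simp flip: assoc_mult_mat[OF GL_carrier[OF g(1)] GL_carrier[OF i(1)] GL_carrier[OF h(1)]])
  have ih: "i * h \<in> GL (Suc m)" by (rule GL_mult[OF i(1) h(1)])
  have "kernel_of m l (g * (i * h))" using h(2) eq by simp
  then have "i * h \<in> parabolic m (Suc 0)" by (rule kernel_of_same_coset[OF g(1) ih l g(2)])
  then have "act (Suc m) (i * h) x = x" using x by (simp add: par_invs_def)
  then have "act (Suc m) h x = act (Suc m) g x"
    using eq act_act[OF GL_carrier[OF g(1)] GL_carrier[OF ih], of x] by simp
  then show ?thesis by (simp add: coset_value_def h_def)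
qed

text \<open>The right-hand side does not mention \<open>R\<close>, so the transfer is independent of
  the representatives.\<close>

lemma transfer_eq_sum_functionals:
  fixes R :: "'p::prime_card mod_ring mat set"
  assumes R: "left_coset_reps R (GL (Suc m)) (parabolic m (Suc 0))" and x: "x \<in> par_invs m"
  shows "transfer (Suc m) R x = (\<Sum>l\<in>norm_functionals m. coset_value m x l)"
proof -
  obtain f where f: "bij_betw f R (norm_functionals m)" "\<And>r. r \<in> R \<Longrightarrow> kernel_of m (f r) r"
    using coset_reps_bij[OF R] by metis
  have "(\<Sum>l\<in>norm_functionals m. coset_value m x l) = (\<Sum>r\<in>R. coset_value m x (f r))"
    by (rule sum.reindex_bij_betw[OF f(1), symmetric])
  also have "\<dots> = (\<Sum>r\<in>R. act (Suc m) r x)"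
  proof (intro sum.cong refl coset_value_eq x f)
    fix r assume "r \<in> R"
    then show "f r \<in> norm_functionals m" "r \<in> GL (Suc m)"
      using f(1) R by (auto simp: bij_betw_def left_coset_reps_def)
  qed
  finally show ?thesis by (simp add: transfer_def)
qed

lemma left_coset_reps_translate:
  fixes R :: "'p::prime_card mod_ring mat set"
  assumes R: "left_coset_reps R (GL n) H" and H: "H \<subseteq> GL n" and h: "h \<in> GL n"
  shows "left_coset_reps ((*) h ` R) (GL n) H"
proof -
  obtain i where i: "i \<in> GL n" "h * i = 1\<^sub>m n" "i * h = 1\<^sub>m n" using GL_inverse[OF h] by metis
  have RG: "R \<subseteq> GL n" using R by (simp add: left_coset_reps_def)
  have hi: "h * (i * g) = g" and ih: "i * (h * g) = g" if "g \<in> GL n" for g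
    using i GL_carrier[OF that]
    by (simp_all flip: assoc_mult_mat[OF GL_carrier[OF h] GL_carrier[OF i(1)] GL_carrier[OF that]]
          assoc_mult_mat[OF GL_carrier[OF i(1)] GL_carrier[OF h] GL_carrier[OF that]])
  have coset: "g = h * r * k \<longleftrightarrow> i * g = r * k" if "g \<in> GL n" "r \<in> R" "k \<in> H" for g r k
  proof -
    have rk: "r \<in> GL n" "k \<in> GL n" using that RG H by auto
    have "h * r * k = h * (r * k)"
      by (rule assoc_mult_mat[OF GL_carrier[OF h] GL_carrier[OF rk(1)] GL_carrier[OF rk(2)]])
    then show ?thesis using hi[OF that(1)] ih[OF GL_mult[OF rk]] by metis
  qed
  show ?thesis unfolding left_coset_reps_def
  proof (intro conjI ballI)
    show "(*) h ` R \<subseteq> GL n" using RG GL_mult[OF h] by auto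
    fix g :: "'p mod_ring mat" assume g: "g \<in> GL n"
    obtain r where r: "r \<in> R" "\<exists>k\<in>H. i * g = r * k"
      and uniq: "\<And>s. s \<in> R \<Longrightarrow> \<exists>k\<in>H. i * g = s * k \<Longrightarrow> s = r"
      using R GL_mult[OF i(1) g] unfolding left_coset_reps_def by metis
    show "\<exists>!s. s \<in> (*) h ` R \<and> (\<exists>k\<in>H. g = s * k)"
    proof (rule ex1I[of _ "h * r"])
      show "h * r \<in> (*) h ` R \<and> (\<exists>k\<in>H. g = h * r * k)" using r coset[OF g] by blast
      fix s assume "s \<in> (*) h ` R \<and> (\<exists>k\<in>H. g = s * k)"
      then obtain s' k where "s = h * s'" "s' \<in> R" "k \<in> H" "g = h * s' * k" by blast
      then show "s = h * r" using uniq coset[OF g] by blast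
    qed
  qed
qed

text \<open>Applying \<open>h\<close> replaces the representatives by their translates, which
  represent the same cosets, and the transfer does not see the difference.\<close>

lemma transfer_in_sym_invs:
  fixes R :: "'p::prime_card mod_ring mat set"
  assumes R: "left_coset_reps R (GL (Suc m)) (parabolic m (Suc 0))" and x: "x \<in> par_invs m"
  shows "transfer (Suc m) R x \<in> sym_invs m"
proof -
  have "act (Suc m) h (transfer (Suc m) R x) = transfer (Suc m) R x" if h: "h \<in> GL (Suc m)" for h
  proof -
    obtain i where i: "i \<in> GL (Suc m)" "i * h = 1\<^sub>m (Suc m)" using GL_inverse[OF h] by metis
    have RG: "R \<subseteq> GL (Suc m)" using R by (simp add: left_coset_reps_def)
    have "i * (h * g) = g" if "g \<in> R" for g
    proof -
      have "g \<in> carrier_mat (Suc m) (Suc m)" using that RG GL_carrier by blast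
      then show ?thesis using i
        by (simp flip: assoc_mult_mat[OF GL_carrier[OF i(1)] GL_carrier[OF h]])
    qed
    then have inj: "inj_on ((*) h) R" by (metis inj_onI)
    have "act (Suc m) h (transfer (Suc m) R x) = (\<Sum>g\<in>R. act (Suc m) (h * g) x)"
      unfolding transfer_def act.hom_sum
      using RG by (intro sum.cong refl act_act GL_carrier h) auto
    also have "\<dots> = transfer (Suc m) ((*) h ` R) x"
      by (simp add: transfer_def sum.reindex[OF inj])
    also have "\<dots> = transfer (Suc m) R x"
      using transfer_eq_sum_functionals[OF R x]
        transfer_eq_sum_functionals[OF left_coset_reps_translate[OF R parabolic_subset_GL h] x] by simp
    finally show ?thesis .
  qed
  then show ?thesis by (simp add: sym_invs_def)
qed

subsection \<open>Divisibility of transfers\<close>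

text \<open>Rescaling the summation variable by \<open>a\<close> multiplies the sum by
  \<open>a ^ k\<close>. A nonzero sum would turn all p - 1 units into roots of x^k - 1, whose degree
  is too small. For \<open>k = 0\<close> the sum is p.\<close>

lemma sum_powers_mod_ring:
  assumes "k < CARD('p::prime_card) - 1"
  shows "(\<Sum>c\<in>UNIV. (c :: 'p mod_ring) ^ k) = 0"
proof (cases "k = 0")
  case False
  let ?S = "\<Sum>c\<in>UNIV. (c :: 'p mod_ring) ^ k"
  show ?thesis
  proof (rule ccontr)
    assume nz: "?S \<noteq> 0"
    have root: "a ^ k = 1" if a: "a \<noteq> 0" for a :: "'p mod_ring"
    proof -
      have "?S = (\<Sum>c\<in>UNIV. (a * c) ^ k)"
        by (rule sum.reindex_bij_witness[of _ "\<lambda>c. a * c" "\<lambda>c. c / a"]) (use a in auto)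
      also have "\<dots> = a ^ k * ?S" by (simp add: power_mult_distrib sum_distrib_left)
      finally show ?thesis using nz by simp
    qed
    define q where "q = monom (1 :: 'p mod_ring) k + (- 1)"
    have dq: "degree q = k"
      using False unfolding q_def by (subst degree_add_eq_left) (simp_all add: degree_monom_eq)
    then have q: "q \<noteq> 0" using False by auto
    have "UNIV - {0} \<subseteq> {x. poly q x = 0}" by (auto simp: q_def poly_monom root)
    then have "card (UNIV - {0 :: 'p mod_ring}) \<le> card {x. poly q x = 0}"
      by (intro card_mono poly_roots_finite q)
    also have "\<dots> \<le> k" using card_poly_roots_bound[OF q] dq by simp
    finally show False using assms by (simp add: card_Diff_singleton)
  qed
qed simp

text \<open>In the binomial expansion x^k is accompanied by the k-th power sum over the prime field,
  which vanishes for k < p - 1.\<close>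

lemma sum_shifts_dvd:
  fixes x y :: "'p::prime_card fpoly"
  shows "x ^ (CARD('p) - 1) dvd (\<Sum>c\<in>UNIV. (y - Const c * x) ^ e)"
proof -
  have "(\<Sum>c\<in>UNIV. (y - Const c * x) ^ e) =
      (\<Sum>c\<in>UNIV. \<Sum>k\<le>e. of_nat (e choose k) * (- (Const c * x)) ^ k * y ^ (e - k))"
    by (simp flip: binomial_ring)
  also have "\<dots> = (\<Sum>k\<le>e. \<Sum>c\<in>UNIV. of_nat (e choose k) * (- (Const c * x)) ^ k * y ^ (e - k))"
    by (rule sum.swap)
  also have "\<dots> = (\<Sum>k\<le>e. of_nat (e choose k) * ((-1) ^ k * Const (\<Sum>c\<in>UNIV. c ^ k) * x ^ k) * y ^ (e - k))"
  proof -
    have "(- (Const c * x)) ^ k = (-1) ^ k * Const (c ^ k) * x ^ k" for c k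
      by (subst power_minus) (simp add: power_mult_distrib Const_power mult.assoc)
    then show ?thesis by (simp add: Const_sum sum_distrib_left sum_distrib_right)
  qed
  also have "x ^ (CARD('p) - 1) dvd \<dots>"
  proof (rule dvd_sum)
    fix k
    show "x ^ (CARD('p) - 1) dvd
        of_nat (e choose k) * ((-1) ^ k * Const (\<Sum>c\<in>UNIV. c ^ k) * x ^ k) * y ^ (e - k)"
    proof (cases "k < CARD('p) - 1")
      case True
      then show ?thesis by (simp add: sum_powers_mod_ring)
    next
      case False
      then have "x ^ (CARD('p) - 1) dvd x ^ k" by (intro le_imp_power_dvd) simp
      then show ?thesis by (intro dvd_mult dvd_mult2)
    qed
  qed
  finally show ?thesis .
qed

text \<open>For \<open>l 0 = 1\<close> this is the action of the unitriangular matrix that fixes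
  \<open>Y 0\<close> and carries the kernel of the functional (1, 0, ..., 0) to the kernel of
  \<open>l\<close>.\<close>

definition shear :: "(nat \<Rightarrow> 'p mod_ring) \<Rightarrow> nat \<Rightarrow> 'p::prime_card fpoly" where
  "shear l k = (if k = 0 then Y 0 else Y k - Const (l k) * Y 0)"

text \<open>The coordinates \<open>l 1\<close>, ..., \<open>l m\<close> vary independently, so on a
  monomial the sum factors over the variables, and each of the \<open>m\<close> variables other than
  \<open>Y 0\<close> yields a factor divisible by the (p-1)-st power of \<open>Y 0\<close>.\<close>

lemma sum_shears_dvd:
  fixes G :: "'p::prime_card fpoly"
  assumes "G \<in> polys (Suc m)"
  shows "Y 0 ^ ((CARD('p) - 1) * m) dvd (\<Sum>l\<in>functionals m 0. subst (shear l) G)"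
proof -
  let ?B = "\<lambda>i. if i < 0 then {0} else if i = 0 then {1} else UNIV :: 'p mod_ring set"
  let ?s = "\<lambda>k c. if k = 0 then Y 0 else Y k - Const c * Y 0 :: 'p fpoly"
  let ?e = "Poly_Mapping.lookup"
  have "(\<Sum>l\<in>functionals m 0. subst (shear l) G) =
      (\<Sum>l\<in>functionals m 0. \<Sum>\<mu>\<in>Poly_Mapping.keys G. Const (?e G \<mu>) * (\<Prod>k\<le>m. shear l k ^ ?e \<mu> k))"
    unfolding subst_def
    using assms by (intro sum.cong refl arg_cong2[where f = "(*)"] monomial_value_superset)
      (auto simp: polys_def less_Suc_eq_le subset_iff)
  also have "\<dots> = (\<Sum>\<mu>\<in>Poly_Mapping.keys G. Const (?e G \<mu>) *
      (\<Sum>l\<in>functionals m 0. \<Prod>k\<le>m. shear l k ^ ?e \<mu> k))"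
    unfolding sum_distrib_left by (rule sum.swap)
  also have "\<dots> = (\<Sum>\<mu>\<in>Poly_Mapping.keys G. Const (?e G \<mu>) *
      (\<Prod>k\<le>m. \<Sum>c\<in>?B k. ?s k c ^ ?e \<mu> k))"
    unfolding functionals_def shear_def by (subst prod_sum_PiE) simp_all
  also have "Y 0 ^ ((CARD('p) - 1) * m) dvd \<dots>"
  proof (intro dvd_sum dvd_mult)
    fix \<mu>
    have "(Y 0 :: 'p fpoly) ^ ((CARD('p) - 1) * m) = (\<Prod>k\<le>m. if k = 0 then 1 else Y 0 ^ (CARD('p) - 1))"
    proof -
      have "{..m} = insert 0 {1..m}" by auto
      then show ?thesis by (simp add: power_mult)
    qed
    also have "\<dots> dvd (\<Prod>k\<le>m. \<Sum>c\<in>?B k. ?s k c ^ ?e \<mu> k)"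
      by (rule prod_dvd_prod) (simp add: sum_shifts_dvd[unfolded One_nat_def])
    finally show "(Y 0 :: 'p fpoly) ^ ((CARD('p) - 1) * m) dvd (\<Prod>k\<le>m. \<Sum>c\<in>?B k. ?s k c ^ ?e \<mu> k)" .
  qed
  finally show ?thesis .
qed

text \<open>The form w is a root of \<open>span_poly m\<close>. Cancelling one w leaves the lowest
  coefficient plus terms with the exponents p^i - 1 for i > 0, and these are at least p - 1.\<close>

lemma linear_form_power_dvd_dickson:
  assumes w: "lin_form m v \<noteq> (0 :: 'p::prime_card fpoly)"
  shows "lin_form m v ^ (CARD('p) - 1) dvd (dickson m 0 :: 'p fpoly)"
proof -
  let ?w = "lin_form m v :: 'p fpoly"
  have p: "CARD('p) ^ i \<ge> CARD('p)" if "i > 0" for i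
    using that CARD_gt_1[where ?'p = 'p] by (simp add: self_le_power)
  have "?w * (\<Sum>i\<le>m. span_coeff m i * ?w ^ (CARD('p) ^ i - 1)) = span_poly m ?w"
    unfolding span_poly_def additive_poly_def sum_distrib_left
  proof (intro sum.cong refl)
    fix i
    have "CARD('p) ^ i = Suc (CARD('p) ^ i - 1)" using CARD_gt_1[where ?'p = 'p] by simp
    then have "?w ^ (CARD('p) ^ i) = ?w * ?w ^ (CARD('p) ^ i - 1)" by (metis power_Suc)
    then show "?w * (span_coeff m i * ?w ^ (CARD('p) ^ i - 1)) = span_coeff m i * ?w ^ (CARD('p) ^ i)"
      by (simp add: mult_ac)
  qed
  then have "(\<Sum>i\<le>m. span_coeff m i * ?w ^ (CARD('p) ^ i - 1)) = 0"
    using w by (simp add: span_poly_lin_form)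
  then have "span_coeff m 0 = - (\<Sum>i\<in>{..m} - {0}. span_coeff m i * ?w ^ (CARD('p) ^ i - 1))"
    by (subst (asm) sum.remove[of _ 0]) (simp_all add: eq_neg_iff_add_eq_0)
  also have "?w ^ (CARD('p) - 1) dvd \<dots>"
    unfolding dvd_minus_iff
    by (intro dvd_sum dvd_mult le_imp_power_dvd) (use p in \<open>auto intro: diff_le_mono\<close>)
  finally show ?thesis by (simp add: dickson_eq dvd_mult)
qed

text \<open>A hyperplane containing \<open>Y 0\<close> contributes a multiple of the power, since its invariant
  corresponding to \<open>dickson m 0\<close> is divisible by \<open>Y 0 ^ (p - 1)\<close>. The other hyperplanes are
  permuted simply transitively by the shears.\<close>

lemma transfer_dvd_Y0:
  fixes f :: "'p::prime_card fpoly"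
  assumes f: "f \<in> par_invs m"
  shows "Y 0 ^ ((CARD('p) - 1) * m) dvd (\<Sum>l\<in>norm_functionals m. coset_value m (f * dickson m 0 ^ m) l)"
proof -
  let ?x = "f * dickson m 0 ^ m"
  have x: "?x \<in> par_invs m" by (intro par_invs_ring f dickson_in_par_invs) simp
  define l0 where "l0 = restrict (\<lambda>i. if i = 0 then 1 else 0 :: 'p mod_ring) {..m}"
  have l0: "l0 \<in> functionals m 0" by (auto simp: functionals_def l0_def)
  have fun0: "functionals m 0 \<subseteq> norm_functionals m" by (auto simp: norm_functionals_def)
  obtain g where g: "g \<in> GL (Suc m)" "kernel_of m l0 g"
    using kernel_of_exists l0 fun0 by blast
  define G where "G = act (Suc m) g ?x"
  have shear: "coset_value m ?x l = subst (shear l) G" if l: "l \<in> functionals m 0" for l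
  proof -
    have lz: "l 0 = 1" using functionals_lead(1)[OF l] by simp
    define u where "u = mat (Suc m) (Suc m) (\<lambda>(i, k). if i = k then 1 else if i = 0 then - l k else 0)"
    have uc: "u \<in> carrier_mat (Suc m) (Suc m)" by (simp add: u_def)
    have "upper_triangular u" by (auto simp: u_def upper_triangular_def)
    then have "det u = prod_list (diag_mat u)" using uc by (rule det_upper_triangular)
    also have "diag_mat u = map (\<lambda>i. 1) [0..<Suc m]"
      unfolding diag_mat_def using uc by (intro map_cong) (auto simp: u_def)
    finally have "det u = 1" by (simp add: map_replicate_const)
    then have uG: "u \<in> GL (Suc m)" using uc by (simp add: GL_iff_det)
    have col: "(\<Sum>i\<le>m. l i * u $$ (i, k)) = l0 k" if k: "k \<le> m" for k
    proof (cases "k = 0")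
      case True
      have "(\<Sum>i\<le>m. l i * u $$ (i, k)) = (\<Sum>i\<in>{0}. l i * u $$ (i, k))"
        by (rule sum.mono_neutral_right) (auto simp: u_def True)
      then show ?thesis using True lz by (simp add: u_def l0_def)
    next
      case False
      have "(\<Sum>i\<le>m. l i * u $$ (i, k)) = (\<Sum>i\<in>{0, k}. l i * u $$ (i, k))"
        by (rule sum.mono_neutral_right) (use k in \<open>auto simp: u_def\<close>)
      then show ?thesis using False lz k by (simp add: u_def l0_def)
    qed
    have "kernel_of m l (u * g)" unfolding kernel_of_def
    proof (intro allI impI)
      fix j assume j: "j < m"
      have "(\<Sum>i\<le>m. l i * (u * g) $$ (i, j)) = (\<Sum>i\<le>m. \<Sum>k\<le>m. l i * (u $$ (i, k) * g $$ (k, j)))"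
        using j by (intro sum.cong refl)
          (simp add: index_mult_mat_sum[OF uc GL_carrier[OF g(1)]] lessThan_Suc_atMost
            sum_distrib_left del: sum.lessThan_Suc)
      also have "\<dots> = (\<Sum>k\<le>m. (\<Sum>i\<le>m. l i * u $$ (i, k)) * g $$ (k, j))"
        unfolding sum_distrib_right mult.assoc by (rule sum.swap)
      also have "\<dots> = (\<Sum>k\<le>m. l0 k * g $$ (k, j))" by (simp add: col)
      finally show "(\<Sum>i\<le>m. l i * (u * g) $$ (i, j)) = 0" using g j by (simp add: kernel_of_def)
    qed
    then have "coset_value m ?x l = act (Suc m) (u * g) ?x"
      using l fun0 by (intro coset_value_eq x GL_mult uG g) auto
    also have "\<dots> = act (Suc m) u G"
      unfolding G_def by (rule act_act[OF uc GL_carrier[OF g(1)], symmetric])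
    also have "\<dots> = subst (shear l) G"
      unfolding act_eq_subst
    proof (rule subst_cong)
      show "G \<in> polys (Suc m)" unfolding G_def by (rule act_in_polys)
      fix k assume k: "k < Suc m"
      have "lin_form (Suc m) (\<lambda>i. u $$ (i, k)) = shear l k"
      proof (cases "k = 0")
        case True
        have "lin_form (Suc m) (\<lambda>i. u $$ (i, k)) = lin_form (Suc m) (\<lambda>i. if i = k then 1 else 0)"
          using k True by (intro lin_form_cong) (simp add: u_def)
        then show ?thesis using k True by (simp add: lin_form_unit shear_def)
      next
        case False
        have "lin_form (Suc m) (\<lambda>i. u $$ (i, k)) = (\<Sum>i\<in>{0, k}. Const (u $$ (i, k)) * Y i)"
          unfolding lin_form_def by (rule sum.mono_neutral_right) (use k in \<open>auto simp: u_def\<close>)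
        then show ?thesis using k False by (simp add: u_def shear_def Const_uminus)
      qed
      then show "(if k < Suc m then lin_form (Suc m) (\<lambda>i. u $$ (i, k)) else 1) = shear l k"
        using k by simp
    qed
    finally show ?thesis .
  qed
  have "Y 0 ^ ((CARD('p) - 1) * m) dvd (\<Sum>l\<in>functionals m 0. coset_value m ?x l)"
    using sum_shears_dvd[OF act_in_polys[of "Suc m" g ?x]] by (simp add: shear G_def)
  moreover have "Y 0 ^ ((CARD('p) - 1) * m) dvd coset_value m ?x l"
    if l: "l \<in> norm_functionals m - functionals m 0" for l
  proof -
    obtain k where k: "k \<le> m" "l \<in> functionals m k" "k \<noteq> 0"
      using l by (auto simp: norm_functionals_def) 
    then have l0: "l 0 = 0" "l k = 1" using functionals_lead[OF k(2,1)] by auto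
    obtain g where g: "g \<in> GL (Suc m)" "kernel_of m l g" using kernel_of_exists l by blast
    obtain h where h: "h \<in> GL (Suc m)" "g * h = 1\<^sub>m (Suc m)" using GL_inverse[OF g(1)] by metis
    \<comment> \<open>The last row of \<open>h\<close> is proportional to \<open>l\<close>, with a
      nonzero factor because \<open>l k = 1\<close>. Its entry at 0 vanishes with
      \<open>l 0\<close>, so \<open>h\<close> maps \<open>Y 0\<close> to a form \<open>w\<close> in
      the first \<open>m\<close> variables.\<close>
    have hm: "h $$ (m, 0) = 0"
      using kernel_of_proportional[OF g(1) h g(2), of 0] kernel_of_proportional[OF g(1) h g(2) k(1)] l0
      by auto
    define w where "w = (lin_form m (\<lambda>i. h $$ (i, 0)) :: 'p fpoly)"
    have gw: "act (Suc m) g w = Y 0"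
    proof -
      have "act (Suc m) h (Y 0) = w"
        unfolding w_def using hm by (simp add: act_Y lin_form_Suc_eq)
      then have "act (Suc m) g w = act (Suc m) (g * h) (Y 0)"
        using act_act[OF GL_carrier[OF g(1)] GL_carrier[OF h(1)], of "Y 0"] by simp
      then show ?thesis by (simp add: h act_one_Y)
    qed
    moreover have "(Y 0 :: 'p fpoly) \<noteq> 0"
      using span_poly_Y_nonzero[of 0, where ?'p = 'p] by (simp add: span_poly_0)
    ultimately have "w \<noteq> 0" by auto
    then obtain q where q: "dickson m 0 = w ^ (CARD('p) - 1) * q"
      unfolding w_def using linear_form_power_dvd_dickson by blast
    have "coset_value m ?x l = act (Suc m) g ?x"
      using l g by (intro coset_value_eq x) auto
    also have "\<dots> = act (Suc m) g f * (Y 0 ^ (CARD('p) - 1) * act (Suc m) g q) ^ m"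
      by (simp add: act.hom_mult act.hom_power q gw)
    also have "\<dots> = Y 0 ^ ((CARD('p) - 1) * m) * (act (Suc m) g f * act (Suc m) g q ^ m)"
      by (simp add: power_mult_distrib mult_ac flip: power_mult)
    finally show ?thesis by simp
  qed
  then have "Y 0 ^ ((CARD('p) - 1) * m) dvd (\<Sum>l\<in>norm_functionals m - functionals m 0. coset_value m ?x l)"
    by (rule dvd_sum)
  ultimately show ?thesis
    by (subst sum.subset_diff[OF fun0 finite_norm_functionals]) (rule dvd_add)
qed

section \<open>From one linear form to all of them: linear factors as primes\<close>

lemma subst_congruence:
  fixes w :: "'p::prime_card fpoly"
  assumes "\<And>k. w dvd s k - t k"
  shows "w dvd subst s f - subst t f"
proof (induction f rule: fpoly_induct)
  case (add f g)
  then show ?case using dvd_add[OF add] by (simp add: subst.hom_add algebra_simps)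
next
  case (mult f g)
  have "subst s (f * g) - subst t (f * g) =
      (subst s f - subst t f) * subst s g + subst t f * (subst s g - subst t g)"
    by (simp add: subst.hom_mult algebra_simps)
  then show ?case using mult by simp
qed (simp_all add: assms)

text \<open>The linear forms that are monic in their last variable \<open>Y k\<close>, one on each
  line of nonzero forms.\<close>

definition linear_factor :: "nat \<Rightarrow> (nat \<Rightarrow> 'p mod_ring) \<Rightarrow> 'p::prime_card fpoly" where
  "linear_factor k v = Y k - lin_form k v"

text \<open>Reduction modulo \<open>linear_factor k v\<close>, realized inside the polynomial ring.
  The multiples of the linear factor are its kernel, and as the ring is a domain the linear factor
  is prime.\<close>

definition kill :: "nat \<Rightarrow> (nat \<Rightarrow> 'p mod_ring) \<Rightarrow> 'p::prime_card fpoly \<Rightarrow> 'p fpoly" where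
  "kill k v = subst (Y(k := lin_form k v))"

interpretation kill: comm_ring_hom "kill k v" for k v
  unfolding kill_def ..

lemma kill_Y: "kill k v (Y j) = (if j = k then lin_form k v else Y j)"
  by (simp add: kill_def)

lemma kill_Const [simp]: "kill k v (Const c) = Const c"
  by (simp add: kill_def)

lemma kill_lin_form: "kill k v (lin_form k w) = lin_form k w"
  by (simp add: lin_form_def kill.hom_sum kill.hom_mult kill_Y)

lemma kill_eq_0_imp_dvd:
  assumes "kill k v f = 0" shows "linear_factor k v dvd f"
proof -
  have "linear_factor k v dvd subst Y f - subst (Y(k := lin_form k v)) f"
    by (rule subst_congruence) (simp add: linear_factor_def)
  then show ?thesis using assms by (simp add: subst_Y_id kill_def)
qed

lemma linear_factor_power_dvd_mult:
  assumes "linear_factor k v ^ s dvd P * Q" "kill k v P \<noteq> 0"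
  shows "linear_factor k v ^ s dvd (Q :: 'p::prime_card fpoly)"
  using assms(1)
proof (induction s arbitrary: Q)
  case (Suc s)
  let ?l = "linear_factor k v :: 'p fpoly"
  from Suc.prems obtain X where X: "P * Q = ?l ^ Suc s * X" by blast
  have kl: "kill k v ?l = 0"
    by (simp add: linear_factor_def kill.hom_minus kill_Y kill_lin_form)
  have l: "?l \<noteq> 0"
  proof
    assume "?l = 0"
    then have "subst (\<lambda>j. if j = k then 1 else 0) ?l = 0" by simp
    then show False
      by (simp add: linear_factor_def subst.hom_minus lin_form_def subst.hom_sum subst.hom_mult)
  qed
  have "kill k v (P * Q) = 0" by (simp add: X kill.hom_mult kl)
  then have "kill k v Q = 0" using assms(2) by (simp add: kill.hom_mult)
  then obtain Q' where Q': "Q = ?l * Q'" using kill_eq_0_imp_dvd by blast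
  have "?l * (P * Q') = ?l * (?l ^ s * X)" using X Q' by (simp add: mult_ac)
  then have "P * Q' = ?l ^ s * X" using l by simp
  then have "?l ^ s dvd P * Q'" by simp
  then have "?l ^ s dvd Q'" by (rule Suc.IH)
  then show ?case using Q' by (simp add: mult_dvd_mono)
qed simp

text \<open>Distinct linear factors are coprime. For different last variables, \<open>Y j\<close>
  survives the reduction with coefficient 1, because only variables below \<open>j\<close> can arise
  from \<open>lin_form j w\<close>; \<open>?z\<close> reads off this coefficient.\<close>

lemma kill_linear_factor_nonzero:
  fixes v w :: "nat \<Rightarrow> 'p::prime_card mod_ring"
  assumes "k \<noteq> j \<or> lin_form k v \<noteq> lin_form k w"
  shows "kill k v (linear_factor j w) \<noteq> 0"
proof (cases "k = j")
  case True
  then show ?thesis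
    using assms by (simp add: linear_factor_def kill.hom_minus kill_Y kill_lin_form)
next
  case False
  let ?z = "subst (\<lambda>i. if i = j then 1 else 0 :: 'p fpoly)"
  have "?z (kill k v (lin_form j w)) = 0"
    using False unfolding lin_form_def kill.hom_sum kill.hom_mult kill_Const kill_Y
      subst.hom_sum subst.hom_mult subst_Const
    by (intro sum.neutral) (auto simp: subst.hom_sum subst.hom_mult)
  then have "?z (kill k v (linear_factor j w)) = 1"
    using False by (simp add: linear_factor_def kill.hom_minus kill_Y subst.hom_minus)
  then show ?thesis by auto
qed

lemma prod_linear_factors_dvd:
  fixes H :: "'p::prime_card fpoly"
  assumes "finite I" "\<And>k v. (k, v) \<in> I \<Longrightarrow> linear_factor k v ^ s dvd H"
    and "\<And>k v w. (k, v) \<in> I \<Longrightarrow> (k, w) \<in> I \<Longrightarrow> v \<noteq> w \<Longrightarrow> (lin_form k v :: 'p fpoly) \<noteq> lin_form k w"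
  shows "(\<Prod>(k, v)\<in>I. linear_factor k v ^ s) dvd H"
  using assms
proof (induction I rule: finite_induct)
  case (insert kv I)
  obtain k v where kv: "kv = (k, v)" by force
  let ?P = "\<Prod>(k, v)\<in>I. linear_factor k v ^ s :: 'p fpoly"
  have "?P dvd H" by (rule insert.IH) (use insert.prems in auto)
  then obtain Q where Q: "H = ?P * Q" by blast
  have "kill k v (linear_factor j w) \<noteq> 0" if "(j, w) \<in> I" for j w
  proof (rule kill_linear_factor_nonzero)
    have "v \<noteq> w" if "k = j" using that \<open>(j, w) \<in> I\<close> insert.hyps kv by auto
    then show "k \<noteq> j \<or> (lin_form k v :: 'p fpoly) \<noteq> lin_form k w"
      using insert.prems(2)[of k v w] that kv by auto
  qed
  then have "kill k v ?P \<noteq> 0"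
    using insert.hyps(1) by (auto simp: kill.hom_prod kill.hom_power)
  moreover have "linear_factor k v ^ s dvd ?P * Q"
    using insert.prems(1)[of k v] kv Q by simp
  ultimately have "linear_factor k v ^ s dvd Q" by (rule linear_factor_power_dvd_mult[rotated])
  then have "linear_factor k v ^ s * ?P dvd H" unfolding Q by (simp add: mult.commute mult_dvd_mono)
  then show ?case using insert.hyps kv by simp
qed simp

lemma monic_eq_prod_roots:
  fixes q :: "'a::idom poly"
  assumes "finite A" "lead_coeff q = 1" "degree q = card A" "\<And>a. a \<in> A \<Longrightarrow> poly q a = 0"
  shows "q = (\<Prod>a\<in>A. [:- a, 1:])"
proof (rule ccontr)
  let ?P = "\<Prod>a\<in>A. [:- a, 1:]"
  assume "q \<noteq> ?P"
  then have nz: "q - ?P \<noteq> 0" by simp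
  have dP: "degree ?P = card A" by (subst degree_prod_eq_sum_degree) auto
  have lP: "lead_coeff ?P = 1" by (simp add: lead_coeff_prod)
  have "card A > 0"
  proof (rule ccontr)
    assume "\<not> card A > 0"
    then have "A = {}" using assms(1) by auto
    then show False using \<open>q \<noteq> ?P\<close> assms by (metis card.empty degree_eq_zeroE lead_coeff_pCons(2) one_pCons prod.empty)
  qed
  have "degree (q - ?P) < card A"
  proof -
    have "coeff (q - ?P) (card A) = 0" using assms dP lP by simp
    moreover have "degree (q - ?P) \<le> card A" using assms dP by (intro degree_diff_le) simp_all
    ultimately show ?thesis using nz by (metis leading_coeff_0_iff le_neq_implies_less)
  qed
  moreover have "card A \<le> card {x. poly (q - ?P) x = 0}"
    using assms(1,4) by (intro card_mono poly_roots_finite nz) (auto simp: poly_prod)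
  ultimately show False using card_poly_roots_bound[OF nz] by linarith
qed

definition coeff_vectors :: "nat \<Rightarrow> (nat \<Rightarrow> 'p::prime_card mod_ring) set" where
  "coeff_vectors k = PiE {..<k} (\<lambda>_. UNIV)"

lemma lin_form_inject:
  assumes "lin_form k v = (lin_form k w :: 'p::prime_card fpoly)" "i < k"
  shows "v i = w i"
proof -
  have "subst (\<lambda>j. if j = i then 1 else 0) (lin_form k u :: 'p fpoly) = Const (u i)" for u
    using assms(2) by (simp add: lin_form_def subst.hom_sum subst.hom_mult if_distrib cong: if_cong)
  then have "Const (v i) = (Const (w i) :: 'p fpoly)" using assms(1) by metis
  then have "Const (v i - w i) = (0 :: 'p fpoly)"
    using Const_add[of "v i - w i" "w i"] by simp
  then show ?thesis by (simp only: Const_eq_0_iff) simp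
qed

lemma lin_form_inj_on: "inj_on (lin_form k) (coeff_vectors k :: (nat \<Rightarrow> 'p::prime_card mod_ring) set)"
proof (rule inj_onI)
  fix v w :: "nat \<Rightarrow> 'p mod_ring"
  assume "v \<in> coeff_vectors k" "w \<in> coeff_vectors k" "lin_form k v = lin_form k w"
  then show "v = w"
    unfolding coeff_vectors_def by (intro PiE_ext[of v _ _ w]) (auto intro: lin_form_inject)
qed

text \<open>As a polynomial in one unknown it is monic of degree p^k and vanishes at the p^k linear
  forms in the first \<open>k\<close> variables.\<close>

lemma span_poly_prod:
  "span_poly k x = (\<Prod>v\<in>coeff_vectors k. x - (lin_form k v :: 'p::prime_card fpoly))"
proof -
  define q where "q = (\<Sum>i\<le>k. monom (span_coeff k i :: 'p fpoly) (CARD('p) ^ i))"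
  let ?A = "lin_form k ` coeff_vectors k :: 'p fpoly set"
  have fin: "finite (coeff_vectors k :: (nat \<Rightarrow> 'p mod_ring) set)"
    unfolding coeff_vectors_def by (intro finite_PiE) auto
  have card: "card ?A = CARD('p) ^ k"
    by (simp add: card_image[OF lin_form_inj_on]) (simp add: coeff_vectors_def card_PiE)
  have pq: "poly q y = span_poly k y" for y
    by (simp add: q_def poly_sum poly_monom span_poly_def additive_poly_def)
  have inj: "CARD('p) ^ i = CARD('p) ^ j \<longleftrightarrow> i = j" for i j
    using CARD_gt_1[where ?'p = 'p] by (simp add: power_inject_exp)
  have ck: "coeff q (CARD('p) ^ k) = 1"
    by (simp add: q_def coeff_sum inj)
  have "degree q \<le> CARD('p) ^ k" unfolding q_def
  proof (intro degree_sum_le)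
    fix i assume "i \<in> {..k}"
    then have "CARD('p) ^ i \<le> CARD('p) ^ k"
      using CARD_gt_1[where ?'p = 'p] by (intro power_increasing) auto
    then show "degree (monom (span_coeff k i :: 'p fpoly) (CARD('p) ^ i)) \<le> CARD('p) ^ k"
      using degree_monom_le order_trans by blast
  qed simp
  then have dq: "degree q = CARD('p) ^ k"
    using ck by (metis le_antisym le_degree zero_neq_one)
  have "q = (\<Prod>a\<in>?A. [:- a, 1:])"
    by (rule monic_eq_prod_roots) (use fin dq ck card in \<open>auto simp: pq span_poly_lin_form\<close>)
  then have "poly q x = (\<Prod>a\<in>?A. x - a)" by (simp add: poly_prod)
  then show ?thesis by (simp add: pq prod.reindex[OF lin_form_inj_on])
qed

lemma dickson_0_prod: "dickson n 0 = (\<Prod>k<n. top_class k :: 'p::prime_card fpoly)"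
  by (induction n) (simp_all add: dickson_Suc_0 mult.commute)

text \<open>This complete factorization reduces divisibility by a power of
  \<open>dickson n 0\<close> to divisibility by the powers of single linear factors.\<close>

lemma dickson_0_power_eq:
  "(dickson n 0 :: 'p::prime_card fpoly) ^ e =
    (\<Prod>(k, v)\<in>Sigma {..<n} coeff_vectors. linear_factor k v ^ ((CARD('p) - 1) * e))"
proof -
  have fin: "finite (coeff_vectors k :: (nat \<Rightarrow> 'p mod_ring) set)" for k
    unfolding coeff_vectors_def by (intro finite_PiE) auto
  have "(dickson n 0 :: 'p fpoly) ^ e = (\<Prod>k<n. span_poly k (Y k) ^ ((CARD('p) - 1) * e))"
    by (simp add: dickson_0_prod top_class_def power_mult prod_power_distrib)
  also have "\<dots> = (\<Prod>k<n. \<Prod>v\<in>coeff_vectors k. linear_factor k v ^ ((CARD('p) - 1) * e))"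
    by (simp add: span_poly_prod linear_factor_def prod_power_distrib)
  also have "\<dots> = (\<Prod>(k, v)\<in>Sigma {..<n} coeff_vectors. linear_factor k v ^ ((CARD('p) - 1) * e))"
    by (subst prod.Sigma) (auto simp: fin)
  finally show ?thesis .
qed

text \<open>The general linear group is transitive on nonzero linear forms: a matrix whose first
  column holds the coefficients of the linear factor carries \<open>Y 0\<close> to it and fixes
  \<open>H\<close>.\<close>

lemma sym_inv_linear_factor_dvd:
  assumes H: "(H :: 'p::prime_card fpoly) \<in> sym_invs m" and dvd: "Y 0 ^ s dvd H" and k: "k < Suc m"
  shows "linear_factor k v ^ s dvd H"
proof -
  define u where "u = (\<lambda>i. if i = k then 1 else if i < k then - v i else 0)"
  have "lin_form (Suc m) u = (\<Sum>i\<in>insert k {..<k}. Const (u i) * Y i)"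
    unfolding lin_form_def by (rule sum.mono_neutral_right) (use k in \<open>auto simp: u_def\<close>)
  also have "\<dots> = linear_factor k v"
    by (simp add: u_def linear_factor_def lin_form_def Const_uminus sum_negf)
  finally have u: "lin_form (Suc m) u = linear_factor k v" .
  obtain g where g: "g \<in> GL (Suc m)" "\<And>j. j < Suc m \<Longrightarrow> g $$ (j, 0) = u j"
    using GL_with_col[of 0 "Suc m" k u] k by (auto simp: u_def)
  have "act (Suc m) g (Y 0) = lin_form (Suc m) u"
    using g(2) by (simp add: act_Y cong: lin_form_cong)
  moreover obtain q where "H = Y 0 ^ s * q" using dvd by blast
  moreover have "act (Suc m) g H = H" using H g by (simp add: sym_invs_def)
  ultimately have "H = linear_factor k v ^ s * act (Suc m) g q"
    using u by (metis act.hom_mult act.hom_power)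
  then show ?thesis by simp
qed

lemma dickson_0_nonzero: "dickson n 0 \<noteq> (0 :: 'p::prime_card fpoly)"
  by (simp add: dickson_0_prod top_class_nonzero)

text \<open>As \<open>dickson (Suc m) 0 = top_class m * dickson m 0\<close>, this says that the trace of
  \<open>f / top_class m ^ m\<close> is integral.\<close>

theorem transfer_divisible:
  fixes R :: "'p::prime_card mod_ring mat set"
  assumes R: "left_coset_reps R (GL (Suc m)) (parabolic m (Suc 0))" and f: "f \<in> par_invs m"
  obtains q where "q \<in> sym_invs m"
    "transfer (Suc m) R (f * dickson m 0 ^ m) = dickson (Suc m) 0 ^ m * q"
proof -
  let ?x = "f * dickson m 0 ^ m"
  let ?H = "transfer (Suc m) R ?x"
  have x: "?x \<in> par_invs m" by (intro par_invs_ring f dickson_in_par_invs) simp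
  have H: "?H \<in> sym_invs m" by (rule transfer_in_sym_invs[OF R x])
  have "Y 0 ^ ((CARD('p) - 1) * m) dvd ?H"
    unfolding transfer_eq_sum_functionals[OF R x] by (rule transfer_dvd_Y0[OF f])
  note lf = sym_inv_linear_factor_dvd[OF H this]
  have "dickson (Suc m) 0 ^ m dvd ?H"
    unfolding dickson_0_power_eq[of "Suc m" m]
  proof (rule prod_linear_factors_dvd)
    show "finite (Sigma {..<Suc m} coeff_vectors :: (nat \<times> (nat \<Rightarrow> 'p mod_ring)) set)"
      unfolding coeff_vectors_def by (intro finite_SigmaI finite_PiE) auto
  qed (use lf lin_form_inj_on[where ?'p = 'p] in \<open>auto simp: inj_on_def\<close>)
  then obtain q where q: "?H = dickson (Suc m) 0 ^ m * q" by blast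
  have "act (Suc m) g q = q" if g: "g \<in> GL (Suc m)" for g
  proof -
    have "act (Suc m) g (dickson (Suc m) 0) = dickson (Suc m) 0"
      using dickson_in_sym_invs[of 0 m, where ?'a = 'p] g by (auto simp: sym_invs_def)
    moreover have "act (Suc m) g ?H = ?H" using H g by (simp add: sym_invs_def)
    ultimately have "dickson (Suc m) 0 ^ m * act (Suc m) g q = dickson (Suc m) 0 ^ m * q"
      using q by (metis act.hom_mult act.hom_power)
    then show ?thesis by (simp add: dickson_0_nonzero)
  qed
  then have "q \<in> sym_invs m" by (simp add: sym_invs_def)
  then show ?thesis using that q by blast
qed

subsection \<open>Partial fractions\<close>

text \<open>Compare the coefficients at \<open>degree F - 1\<close> in the interpolation formula for
  \<open>q\<close>, whose building blocks \<open>G z\<close> are the quotients of \<open>F\<close>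
  by its linear factors and take the value F'(z) at z.\<close>

lemma sum_over_roots:
  fixes F q :: "'a::field poly"
  assumes Z: "finite Z" "card Z = degree F" "\<And>z. z \<in> Z \<Longrightarrow> poly F z = 0"
    and F': "\<And>z. z \<in> Z \<Longrightarrow> poly (pderiv F) z \<noteq> 0"
    and q: "degree q < degree F"
  shows "(\<Sum>z\<in>Z. poly q z / poly (pderiv F) z) = coeff q (degree F - 1) / lead_coeff F"
proof -
  define l where "l = lead_coeff F"
  have l: "l \<noteq> 0" using q by (auto simp: l_def)
  define G where "G = (\<lambda>z. smult l (\<Prod>w\<in>Z - {z}. [:- w, 1:]))"
  have "smult (1 / l) F = (\<Prod>z\<in>Z. [:- z, 1:])"
    by (rule monic_eq_prod_roots) (use Z l in \<open>auto simp: l_def\<close>)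
  then have F: "F = smult l (\<Prod>z\<in>Z. [:- z, 1:])"
    using l by (metis divide_self_if smult_1_left smult_smult times_divide_eq_right mult.right_neutral)
  have FG: "F = [:- z, 1:] * G z" if "z \<in> Z" for z
    unfolding F G_def using that Z(1) by (subst prod.remove[of _ z]) (simp_all only: mult_smult_right)
  have dG: "degree (G z) = degree F - 1" if "z \<in> Z" for z
    using that Z(1,2) l unfolding G_def by (simp add: degree_prod_eq_sum_degree card_Diff_singleton)
  have lG: "coeff (G z) (degree F - 1) = l" if "z \<in> Z" for z
  proof -
    have "lead_coeff (G z) = l" by (simp add: G_def lead_coeff_prod)
    then show ?thesis using dG[OF that] by simp
  qed
  have G0: "poly (G z) w = 0" if "w \<in> Z" "w \<noteq> z" for z w
    using that Z(1) by (auto simp: G_def poly_prod)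
  have Gz: "poly (G z) z = poly (pderiv F) z" if "z \<in> Z" for z
    by (subst FG[OF that]) (simp add: pderiv_mult pderiv_pCons del: mult_pCons_left mult_pCons_right)
  define Q where "Q = (\<Sum>z\<in>Z. smult (poly q z / poly (pderiv F) z) (G z))"
  have Qq: "poly Q w = poly q w" if "w \<in> Z" for w
  proof -
    have "poly Q w = (\<Sum>z\<in>Z. if z = w then poly q w else 0)"
      unfolding Q_def poly_sum using that F' G0 Gz by (intro sum.cong) auto
    then show ?thesis using that Z(1) by simp
  qed
  have "degree Q \<le> degree F - 1"
    unfolding Q_def by (intro degree_sum_le) (use Z dG in \<open>auto intro: order_trans[OF degree_smult_le]\<close>)
  then have dQ: "degree (Q - q) < degree F"
    using q degree_diff_le_max[of Q q] by linarith
  have "Q = q"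
  proof (rule ccontr)
    assume "Q \<noteq> q"
    then have nz: "Q - q \<noteq> 0" by simp
    have "card Z \<le> card {x. poly (Q - q) x = 0}"
      using Qq by (intro card_mono poly_roots_finite nz) auto
    then show False using card_poly_roots_bound[OF nz] Z(2) dQ by linarith
  qed
  have "coeff Q (degree F - 1) = (\<Sum>z\<in>Z. poly q z / poly (pderiv F) z) * l"
    by (simp add: Q_def coeff_sum lG[unfolded One_nat_def] sum_distrib_right)
  then show ?thesis using l \<open>Q = q\<close> by (simp add: l_def)
qed

subsection \<open>Dickson invariants of a hyperplane as polynomials in one element\<close>

text \<open>The recursion \<open>dickson_Suc_Suc\<close> solved for the invariants of the hyperplane, with \<open>c i\<close> in
  place of \<open>dickson (Suc m) i\<close> and the variable in place of the inverse of \<open>top_class m\<close>.\<close>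

fun dickson_rec :: "nat \<Rightarrow> (nat \<Rightarrow> 'a::comm_ring_1) \<Rightarrow> nat \<Rightarrow> 'a poly" where
  "dickson_rec p c 0 = [:0, c 0:]"
| "dickson_rec p c (Suc i) = [:0, 1:] * ([:c (Suc i):] - dickson_rec p c i ^ p)"

lemma repunit_0 [simp]: "repunit p 0 = 0"
  by (simp add: repunit_def)

lemma repunit_Suc: "repunit p (Suc k) = Suc (p * repunit p k)"
  by (simp add: repunit_def sum.lessThan_Suc_shift sum_distrib_left del: sum.lessThan_Suc)

lemma dickson_rec_0 [simp]: "coeff (dickson_rec p c i) 0 = 0"
  by (cases i) simp_all

text \<open>The constant \<open>c (Suc i)\<close> never competes with the p-th power, so degrees
  follow the recursion of \<open>repunit\<close>. The recursion of leading coefficients is recorded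
  because it yields the diagonal of the Gram matrix.\<close>

lemma degree_dickson_rec:
  fixes c :: "nat \<Rightarrow> 'a::idom"
  assumes "c 0 \<noteq> 0" "p > 0"
  shows "degree (dickson_rec p c i) = repunit p (Suc i)"
    and "lead_coeff (dickson_rec p c (Suc i)) = - (lead_coeff (dickson_rec p c i) ^ p)"
proof -
  have *: "degree (dickson_rec p c (Suc i)) = repunit p (Suc (Suc i)) \<and>
      lead_coeff (dickson_rec p c (Suc i)) = - (lead_coeff (dickson_rec p c i) ^ p)"
    if d: "degree (dickson_rec p c i) = repunit p (Suc i)" for i
  proof -
    let ?D = "dickson_rec p c i ^ p"
    have dD: "degree ?D = p * repunit p (Suc i)" using d by (subst degree_power_eq) (auto simp: repunit_Suc)
    then have lt: "degree [:c (Suc i):] < degree (- ?D)" using assms by (simp add: repunit_Suc)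
    have dl: "degree ([:c (Suc i):] + - ?D) = p * repunit p (Suc i)"
      by (simp only: degree_add_eq_right[OF lt] degree_minus dD)
    have ll: "lead_coeff ([:c (Suc i):] + - ?D) = - (lead_coeff (dickson_rec p c i) ^ p)"
      by (simp only: lead_coeff_add_le[OF lt] lead_coeff_minus lead_coeff_power)
    have nz: "[:c (Suc i):] + - ?D \<noteq> 0" using dl assms by (auto simp: repunit_Suc)
    have "degree (dickson_rec p c (Suc i)) = Suc (p * repunit p (Suc i))"
    proof -
      have "degree (dickson_rec p c (Suc i)) = degree [:0, 1 :: 'a:] + degree ([:c (Suc i):] + - ?D)"
        using nz by (simp only: dickson_rec.simps diff_conv_add_uminus) (rule degree_mult_eq, simp_all)
      also have "\<dots> = Suc (p * repunit p (Suc i))" unfolding dl by simp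
      finally show ?thesis .
    qed
    moreover have "lead_coeff (dickson_rec p c (Suc i)) = - (lead_coeff (dickson_rec p c i) ^ p)"
    proof -
      have "lead_coeff (dickson_rec p c (Suc i)) = lead_coeff [:0, 1 :: 'a:] * lead_coeff ([:c (Suc i):] + - ?D)"
        by (simp only: dickson_rec.simps diff_conv_add_uminus lead_coeff_mult)
      also have "\<dots> = - (lead_coeff (dickson_rec p c i) ^ p)" unfolding ll by simp
      finally show ?thesis .
    qed
    ultimately show ?thesis by (simp add: repunit_Suc)
  qed
  have d: "degree (dickson_rec p c i) = repunit p (Suc i)" for i
  proof (induction i)
    case (Suc i)
    then show ?case using * by blast
  qed (use assms in \<open>simp add: repunit_def\<close>)
  then show "degree (dickson_rec p c i) = repunit p (Suc i)"
    and "lead_coeff (dickson_rec p c (Suc i)) = - (lead_coeff (dickson_rec p c i) ^ p)"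
    using * by blast+
qed

lemma pderiv_dickson_rec:
  assumes "of_nat p = (0 :: 'a::idom)"
  shows "pderiv (dickson_rec p c (Suc i)) = [:c (Suc i):] - (dickson_rec p c i :: 'a poly) ^ p"
proof (cases p)
  case (Suc k)
  have "pderiv (dickson_rec p c i ^ p) = 0"
    using assms unfolding Suc by (simp only: pderiv_power_Suc) simp
  then show ?thesis by (simp add: pderiv_mult pderiv_diff pderiv_pCons)
qed (simp add: pderiv_mult pderiv_diff pderiv_pCons)

subsection \<open>The basis in terms of digits\<close>

text \<open>Every number below \<open>repunit p (Suc m)\<close> is uniquely a sum of \<open>e i * repunit p (Suc i)\<close> where the
  digits \<open>e i\<close> are less than \<open>p\<close>, except that the lowest nonzero digit may be \<open>p\<close>.\<close>

fun digit_prod :: "nat \<Rightarrow> (nat \<Rightarrow> 'a::comm_semiring_1) \<Rightarrow> nat \<Rightarrow> nat \<Rightarrow> 'a" where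
  "digit_prod p d 0 a = 1"
| "digit_prod p d (Suc m) a =
     d m ^ (a div repunit p (Suc m)) * digit_prod p d m (a mod repunit p (Suc m))"

text \<open>The complement of \<open>digit_prod\<close>: together they contain
  \<open>d m ^ (p - 1) * x\<close> at a level with digit below \<open>p\<close>, so that the degrees
  in \<open>z\<close> add up to \<open>repunit p (Suc m)\<close>. A digit \<open>p\<close> forces
  all lower digits to be 0, and the single factor \<open>u m\<close> fills the gap of degree 1. With
  \<open>x\<close> and \<open>u\<close> equal to \<open>z\<close> this is the polynomial version;
  with 1 and powers of the top class it is the version free of denominators.\<close>

fun dual_prod :: "nat \<Rightarrow> (nat \<Rightarrow> 'a::comm_semiring_1) \<Rightarrow> 'a \<Rightarrow> (nat \<Rightarrow> 'a) \<Rightarrow> nat \<Rightarrow> nat \<Rightarrow> 'a" where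
  "dual_prod p d x u 0 a = d 0"
| "dual_prod p d x u (Suc m) a =
     (if a div repunit p (Suc m) < p
      then d m ^ (p - 1 - a div repunit p (Suc m)) * x * dual_prod p d x u m (a mod repunit p (Suc m))
      else u m)"

lemma digit_prod_0 [simp]: "digit_prod p d m 0 = 1"
  by (induction m) simp_all

lemma digit_cases:
  assumes "a < repunit p (Suc (Suc m))"
  obtains "a div repunit p (Suc m) < p" "a mod repunit p (Suc m) < repunit p (Suc m)"
  | "a = p * repunit p (Suc m)" "a div repunit p (Suc m) = p" "a mod repunit p (Suc m) = 0"
proof -
  have R: "repunit p (Suc m) > 0" by (simp add: repunit_Suc)
  have "a \<le> p * repunit p (Suc m)" using assms by (simp add: repunit_Suc)
  then consider "a < p * repunit p (Suc m)" | "a = p * repunit p (Suc m)" by linarith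
  then show ?thesis
  proof cases
    case 1
    then have "a div repunit p (Suc m) < p" by (simp add: less_mult_imp_div_less)
    then show ?thesis using that(1) R by simp
  next
    case 2
    then show ?thesis using that(2) R by simp
  qed
qed

text \<open>For \<open>a > 0\<close> some \<open>d i\<close> occurs as a factor. Hence every basis
  element other than 1 is \<open>z\<close> times a polynomial in \<open>z\<close>, the shape needed
  for the trace formula.\<close>

lemma digit_prod_coeff_0:
  fixes d :: "nat \<Rightarrow> 'a::idom poly"
  assumes "\<And>i. i < m \<Longrightarrow> coeff (d i) 0 = 0" "0 < a" "a < repunit p (Suc m)"
  shows "coeff (digit_prod p d m a) 0 = 0"
  using assms
proof (induction m arbitrary: a)
  case 0
  then show ?case by (simp add: repunit_Suc)
next
  case (Suc m)
  show ?case
  proof (cases "a div repunit p (Suc m) = 0")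
    case True
    then have "a < repunit p (Suc m)" by (simp add: div_eq_0_iff repunit_Suc)
    then have "coeff (digit_prod p d m a) 0 = 0" using Suc by simp
    then show ?thesis using True \<open>a < repunit p (Suc m)\<close> by (simp add: coeff_mult)
  next
    case False
    then show ?thesis
      using Suc.prems(1)[of m] by (simp add: coeff_mult coeff_0_power)
  qed
qed

lemma dual_prod_coeff_0:
  fixes d :: "nat \<Rightarrow> 'a::idom poly"
  assumes "coeff (d 0) 0 = 0"
  shows "coeff (dual_prod p d [:0, 1:] (\<lambda>_. [:0, 1:]) m a) 0 = 0"
  using assms by (induction m arbitrary: a) (simp_all add: coeff_mult)

text \<open>The degrees are complementary by design. For the leading coefficients, the p - 1 factors
  at one level and the contribution from below combine to a p-th power of the leading coefficient of
  \<open>dickson_rec p c m\<close>, which is up to sign the next leading coefficient.\<close>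

lemma degree_digit_prod:
  fixes c :: "nat \<Rightarrow> 'a::idom"
  assumes "c 0 \<noteq> 0" "p > 0" "a < repunit p (Suc m)"
  shows "degree (digit_prod p (dickson_rec p c) m a) = a"
    and "degree (dual_prod p (dickson_rec p c) [:0, 1:] (\<lambda>_. [:0, 1:]) m a) = repunit p (Suc m) - a"
    and "\<exists>k. lead_coeff (digit_prod p (dickson_rec p c) m a) *
        lead_coeff (dual_prod p (dickson_rec p c) [:0, 1:] (\<lambda>_. [:0, 1:]) m a) =
        (-1) ^ k * lead_coeff (dickson_rec p c m)"
proof -
  let ?d = "dickson_rec p c"
  let ?b = "digit_prod p ?d" and ?s = "dual_prod p ?d [:0, 1:] (\<lambda>_. [:0, 1:])"
  note dd = degree_dickson_rec[where c = c and p = p, OF assms(1,2)]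
  have dnz: "?d i \<noteq> 0" for i using dd(1)[of i] by (auto simp: repunit_Suc)
  have "degree (?b m a) = a \<and> degree (?s m a) = repunit p (Suc m) - a \<and>
      (\<exists>k. lead_coeff (?b m a) * lead_coeff (?s m a) = (-1) ^ k * lead_coeff (?d m))"
    using assms(3)
  proof (induction m arbitrary: a)
    case 0
    then have "a = 0" by (simp add: repunit_Suc)
    then show ?case using assms(1) by (auto simp: repunit_Suc intro!: exI[of _ 0])
  next
    case (Suc m)
    let ?R = "repunit p (Suc m)"
    have ld: "lead_coeff (?d (Suc m)) = - (lead_coeff (?d m) ^ p)" by (rule dd(2))
    from Suc.prems show ?case
    proof (cases rule: digit_cases)
      case 1
      define k where "k = a div ?R"
      define r where "r = a mod ?R"
      have a: "a = k * ?R + r" by (simp only: k_def r_def div_mult_mod_eq)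
      have k: "k < p" using 1 by (simp add: k_def)
      obtain j where IH: "degree (?b m r) = r" "degree (?s m r) = ?R - r"
        and j: "lead_coeff (?b m r) * lead_coeff (?s m r) = (-1) ^ j * lead_coeff (?d m)"
        using Suc.IH[of r] 1(2) unfolding r_def by blast
      have "lead_coeff (?b m r) * lead_coeff (?s m r) \<noteq> 0" unfolding j using dnz by simp
      then have nz: "?b m r \<noteq> 0" "?s m r \<noteq> 0" by auto
      have b: "?b (Suc m) a = ?d m ^ k * ?b m r" by (simp add: k_def r_def)
      have s: "?s (Suc m) a = ?d m ^ (p - 1 - k) * [:0, 1:] * ?s m r"
        using 1 by (simp add: k_def r_def del: mult_pCons_left mult_pCons_right)
      have "degree (?b (Suc m) a) = a"
        unfolding b using nz dnz by (simp add: degree_mult_eq degree_power_eq dd IH a)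
      moreover have "degree (?s (Suc m) a) = repunit p (Suc (Suc m)) - a"
      proof -
        have "degree (?s (Suc m) a) = (p - 1 - k) * ?R + 1 + (?R - r)"
          unfolding s using nz dnz by (simp add: degree_mult_eq degree_power_eq dd IH del: mult_pCons_left mult_pCons_right)
        also have "\<dots> = Suc (p * ?R) - a"
        proof -
          have "r < ?R" using 1 by (simp add: r_def)
          moreover have "p * ?R = (p - 1 - k) * ?R + k * ?R + ?R"
          proof -
            have "p = (p - 1 - k) + k + 1" using k by simp
            then show ?thesis by (metis add_mult_distrib mult_1)
          qed
          ultimately show ?thesis unfolding a by linarith
        qed
        finally show ?thesis by (simp add: repunit_Suc)
      qed
      moreover have "lead_coeff (?b (Suc m) a) * lead_coeff (?s (Suc m) a) =
          (-1) ^ Suc j * lead_coeff (?d (Suc m))"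
      proof -
        have "lead_coeff (?b (Suc m) a) * lead_coeff (?s (Suc m) a) =
            lead_coeff (?d m) ^ (k + (p - 1 - k)) * (lead_coeff (?b m r) * lead_coeff (?s m r))"
          unfolding b s lead_coeff_mult lead_coeff_power power_add by simp
        also have "\<dots> = (-1) ^ j * (lead_coeff (?d m) ^ Suc (k + (p - 1 - k)))"
          unfolding j by (simp only: power_Suc mult_ac)
        also have "Suc (k + (p - 1 - k)) = p" using k by simp
        also have "(-1) ^ j * (lead_coeff (?d m) ^ p) = (-1) ^ Suc j * lead_coeff (?d (Suc m))"
          unfolding ld by simp
        finally show ?thesis .
      qed
      ultimately show ?thesis by blast
    next
      case 2
      have b: "?b (Suc m) a = ?d m ^ p" and s: "?s (Suc m) a = [:0, 1:]"
        using 2 by simp_all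
      have "degree (?b (Suc m) a) = a" unfolding b using dnz 2 by (simp add: degree_power_eq dd)
      moreover have "degree (?s (Suc m) a) = repunit p (Suc (Suc m)) - a"
        unfolding s using 2(1) by (simp add: repunit_Suc)
      moreover have "lead_coeff (?b (Suc m) a) * lead_coeff (?s (Suc m) a) =
          (-1) ^ 1 * lead_coeff (?d (Suc m))"
        unfolding b s ld by (simp add: lead_coeff_power)
      ultimately show ?thesis by blast
    qed
  qed
  then show "degree (?b m a) = a" "degree (?s m a) = repunit p (Suc m) - a"
    "\<exists>k. lead_coeff (?b m a) * lead_coeff (?s m a) = (-1) ^ k * lead_coeff (?d m)" by blast+
qed

text \<open>The first set consists of the numbers without a digit \<open>p\<close>; in the others
  the digit \<open>p\<close> stands at position \<open>t - 1\<close>, with zeros below it. A further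
  digit multiplies all old elements by \<open>d m ^ k\<close> with \<open>k < p\<close> and adds the
  one new element \<open>d m ^ p\<close>.\<close>

lemma digit_prod_image:
  fixes d :: "nat \<Rightarrow> 'a::comm_semiring_1"
  assumes p: "p > 0"
  shows "{\<Prod>i<m. d i ^ e i | e. \<forall>i<m. e i \<le> p - 1} \<union>
     (\<Union>t\<in>{1..m}. {d (t - 1) ^ p * (\<Prod>i\<in>{t..<m}. d i ^ e i) | e. \<forall>i\<in>{t..<m}. e i \<le> p - 1}) =
     digit_prod p d m ` {..<repunit p (Suc m)}"
proof (induction m)
  case 0
  show ?case by (auto simp: repunit_Suc)
next
  case (Suc m)
  let ?A = "\<lambda>m. {\<Prod>i<m. d i ^ e i | e. \<forall>i<m. e i \<le> p - 1}"
  let ?T = "\<lambda>m t. {d (t - 1) ^ p * (\<Prod>i\<in>{t..<m}. d i ^ e i) | e. \<forall>i\<in>{t..<m}. e i \<le> p - 1}"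
  let ?R = "repunit p (Suc m)"
  let ?S = "\<lambda>X. {x * d m ^ k | x k. x \<in> X \<and> k < p}"
  have R: "?R > 0" by (simp add: repunit_Suc)
  have A: "?A (Suc m) = ?S (?A m)"
  proof (intro equalityI subsetI)
    fix y assume "y \<in> ?A (Suc m)"
    then obtain e where e: "y = (\<Prod>i<m. d i ^ e i) * d m ^ e m" "\<forall>i<Suc m. e i \<le> p - 1" by auto
    have "(\<Prod>i<m. d i ^ e i) \<in> ?A m" using e(2) less_Suc_eq by blast
    moreover have "e m < p" using e(2) p by (metis Suc_pred' le_imp_less_Suc lessI)
    ultimately show "y \<in> ?S (?A m)" using e(1) by blast
  next
    fix y assume "y \<in> ?S (?A m)"
    then obtain e k where e: "y = (\<Prod>i<m. d i ^ e i) * d m ^ k" "\<forall>i<m. e i \<le> p - 1" "k < p" by blast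
    have "y = (\<Prod>i<Suc m. d i ^ (e(m := k)) i)" using e(1) by simp
    moreover have "\<forall>i<Suc m. (e(m := k)) i \<le> p - 1" using e(2,3) by (auto simp: less_Suc_eq)
    ultimately show "y \<in> ?A (Suc m)" by blast
  qed
  have T: "?T (Suc m) t = ?S (?T m t)" if t: "t \<in> {1..m}" for t
  proof (intro equalityI subsetI)
    fix y assume "y \<in> ?T (Suc m) t"
    then obtain e where e: "y = d (t - 1) ^ p * (\<Prod>i\<in>{t..<Suc m}. d i ^ e i)" "\<forall>i\<in>{t..<Suc m}. e i \<le> p - 1" by blast
    have "y = d (t - 1) ^ p * (\<Prod>i\<in>{t..<m}. d i ^ e i) * d m ^ e m" using e(1) t by (simp add: mult.assoc)
    moreover have "d (t - 1) ^ p * (\<Prod>i\<in>{t..<m}. d i ^ e i) \<in> ?T m t" using e(2) by fastforce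
    moreover have "e m \<le> p - 1" using e(2) t by simp
    then have "e m < p" using p by linarith
    ultimately show "y \<in> ?S (?T m t)" by blast
  next
    fix y assume "y \<in> ?S (?T m t)"
    then obtain e k where e: "y = d (t - 1) ^ p * (\<Prod>i\<in>{t..<m}. d i ^ e i) * d m ^ k"
      "\<forall>i\<in>{t..<m}. e i \<le> p - 1" "k < p" by blast
    have "y = d (t - 1) ^ p * (\<Prod>i\<in>{t..<Suc m}. d i ^ (e(m := k)) i)"
      using e(1) t by (simp add: mult.assoc)
    moreover have "\<forall>i\<in>{t..<Suc m}. (e(m := k)) i \<le> p - 1" using e(2,3) by auto
    ultimately show "y \<in> ?T (Suc m) t" by blast
  qed
  have "{1..Suc m} = insert (Suc m) {1..m}" by auto
  then have "?A (Suc m) \<union> (\<Union>t\<in>{1..Suc m}. ?T (Suc m) t) =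
      ?A (Suc m) \<union> (\<Union>t\<in>{1..m}. ?T (Suc m) t) \<union> ?T (Suc m) (Suc m)" by auto
  also have "?T (Suc m) (Suc m) = {d m ^ p}" by simp
  also have "(\<Union>t\<in>{1..m}. ?T (Suc m) t) = (\<Union>t\<in>{1..m}. ?S (?T m t))"
    by (rule SUP_cong[OF refl]) (rule T)
  also have "?A (Suc m) \<union> (\<Union>t\<in>{1..m}. ?S (?T m t)) = ?S (?A m \<union> (\<Union>t\<in>{1..m}. ?T m t))"
    unfolding A by blast
  also have "\<dots> = ?S (digit_prod p d m ` {..<?R})" by (simp only: Suc.IH)
  also have "\<dots> \<union> {d m ^ p} = digit_prod p d (Suc m) ` {..<repunit p (Suc (Suc m))}"
  proof (intro equalityI subsetI)
    fix y assume "y \<in> ?S (digit_prod p d m ` {..<?R}) \<union> {d m ^ p}"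
    then consider r k where "r < ?R" "k < p" "y = digit_prod p d m r * d m ^ k" | "y = d m ^ p" by blast
    then show "y \<in> digit_prod p d (Suc m) ` {..<repunit p (Suc (Suc m))}"
    proof cases
      case 1
      have "y = digit_prod p d (Suc m) (k * ?R + r)" using 1 by (simp add: mult.commute)
      moreover have "k * ?R + r < repunit p (Suc (Suc m))"
      proof -
        have "k * ?R + r < Suc k * ?R" using 1 by simp
        also have "\<dots> \<le> p * ?R" using 1 by (intro mult_le_mono1) simp
        finally show ?thesis by (simp add: repunit_Suc)
      qed
      ultimately show ?thesis by blast
    next
      case 2
      have "y = digit_prod p d (Suc m) (p * ?R)" using 2 R by simp
      moreover have "p * ?R < repunit p (Suc (Suc m))" by (simp add: repunit_Suc)
      ultimately show ?thesis by blast
    qed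
  next
    fix y assume "y \<in> digit_prod p d (Suc m) ` {..<repunit p (Suc (Suc m))}"
    then obtain a where a: "a < repunit p (Suc (Suc m))" "y = digit_prod p d (Suc m) a" by blast
    from a(1) show "y \<in> ?S (digit_prod p d m ` {..<?R}) \<union> {d m ^ p}"
    proof (cases rule: digit_cases)
      case 1
      have "y = digit_prod p d m (a mod ?R) * d m ^ (a div ?R)" using a(2) by (simp add: mult.commute)
      then show ?thesis using 1 by blast
    next
      case 2
      then show ?thesis using a(2) by simp
    qed
  qed
  finally show ?case .
qed

subsection \<open>The twisted trace form\<close>

interpretation to_fract: comm_ring_hom to_fract
  by standard simp_all

lemma (in comm_semiring_hom) hom_digit_prod:
  "hom (digit_prod p d m a) = digit_prod p (\<lambda>i. hom (d i)) m a"
  by (induction m arbitrary: a) (simp_all add: hom_mult hom_power)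

lemma (in comm_semiring_hom) hom_dual_prod:
  "hom (dual_prod p d x u m a) = dual_prod p (\<lambda>i. hom (d i)) (hom x) (\<lambda>j. hom (u j)) m a"
  by (induction m arbitrary: a) (simp_all add: hom_mult hom_power)

lemma digit_prod_cong:
  "(\<And>i. i \<le> m \<Longrightarrow> d i = d' i) \<Longrightarrow> digit_prod p d m a = digit_prod p d' m a"
  by (induction m arbitrary: a) simp_all

lemma dual_prod_cong:
  "(\<And>i. i \<le> m \<Longrightarrow> d i = d' i) \<Longrightarrow> dual_prod p d x u m a = dual_prod p d' x u m a"
  by (induction m arbitrary: a) simp_all

text \<open>A full run collects one \<open>x\<close> per level, hence \<open>x ^ m\<close>. If the
  digit \<open>p\<close> ends it early, the power of \<open>e\<close> supplied by \<open>u\<close>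
  makes up for the missing inverse factors.\<close>

lemma dual_prod_scale:
  assumes "x * e = 1"
  shows "dual_prod p d x (\<lambda>_. x) m a = x ^ m * dual_prod p d 1 (\<lambda>j. e ^ j) m a"
proof (induction m arbitrary: a)
  case (Suc m)
  have "x = x ^ Suc m * e ^ m" using assms by (simp add: mult.assoc flip: power_mult_distrib)
  then show ?case by (simp add: Suc mult_ac)
qed simp

lemma digit_prod_in_par_invs:
  "k \<le> m \<Longrightarrow> digit_prod p (dickson m) k a \<in> par_invs m"
proof (induction k arbitrary: a)
  case (Suc k)
  then show ?case
    unfolding digit_prod.simps by (intro par_invs_ring dickson_in_par_invs) simp_all
qed (simp add: par_invs_ring)

lemma dual_prod_in_par_invs:
  "k \<le> m \<Longrightarrow> m \<ge> 1 \<Longrightarrow>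
    dual_prod p (dickson m) 1 (\<lambda>j. top_class m ^ j) k a \<in> (par_invs m :: 'p::prime_card fpoly set)"
proof (induction k arbitrary: a)
  case (Suc k)
  have "top_class m ^ k \<in> (par_invs m :: 'p fpoly set)" by (intro par_invs_ring top_class_in_par_invs Suc)
  moreover have "dickson m k ^ e * 1 * dual_prod p (dickson m) 1 (\<lambda>j. top_class m ^ j) k r \<in> (par_invs m :: 'p fpoly set)" for e r
    using Suc by (intro par_invs_ring dickson_in_par_invs Suc.IH) simp_all
  ultimately show ?case by simp
qed (simp add: dickson_in_par_invs)

lemma of_nat_CARD_fract: "of_nat CARD('p::prime_card) = (0 :: 'p fpoly fract)"
proof -
  have "of_nat CARD('p) = (0 :: 'p fpoly)" using of_nat_CHAR[where ?'a = "'p fpoly"] by (simp add: CHAR_fpoly)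
  then show ?thesis by (metis to_fract.hom_of_nat to_fract.hom_zero)
qed

locale coset_system =
  fixes m :: nat and R :: "'p::prime_card mod_ring mat set"
  assumes reps: "left_coset_reps R (GL (Suc m)) (parabolic m (Suc 0))"
    and m: "m \<ge> 1"
begin

definition index :: nat where "index = repunit CARD('p) (Suc m)"

definition root :: "'p mod_ring mat \<Rightarrow> 'p fpoly fract" where
  "root g = 1 / to_fract (act (Suc m) g (top_class m))"

definition hyper :: "nat \<Rightarrow> 'p fpoly fract poly" where
  "hyper = dickson_rec CARD('p) (\<lambda>i. to_fract (dickson (Suc m) i))"

definition basis :: "nat \<Rightarrow> 'p fpoly" where
  "basis a = digit_prod CARD('p) (dickson m) m a"

definition dual :: "nat \<Rightarrow> 'p fpoly" where
  "dual a = dual_prod CARD('p) (dickson m) 1 (\<lambda>j. top_class m ^ j) m a"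

text \<open>The trace of f z^m. The power is the one split off in \<open>dual_prod_scale\<close>, so
  on products \<open>basis a * dual c\<close> it is the trace of a polynomial in
  \<open>z\<close>.\<close>

definition form :: "'p fpoly \<Rightarrow> 'p fpoly fract" where
  "form f = (\<Sum>g\<in>R. to_fract (act (Suc m) g f) * root g ^ m)"

abbreviation "basis_poly a \<equiv> digit_prod CARD('p) hyper m a"
abbreviation "dual_poly a \<equiv> dual_prod CARD('p) hyper [:0, 1:] (\<lambda>_. [:0, 1:]) m a"

lemma index_pos: "index > 0"
  by (simp add: index_def repunit_Suc)

lemma p_pos: "CARD('p) > 0"
  using CARD_gt_1[where ?'p = 'p] by simp

lemma R_GL: "g \<in> R \<Longrightarrow> g \<in> GL (Suc m)"
  using reps by (auto simp: left_coset_reps_def)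

lemma finite_R: "finite R" and card_R: "card R = index"
proof -
  obtain f where f: "bij_betw f R (norm_functionals m :: (nat \<Rightarrow> 'p mod_ring) set)"
    using coset_reps_bij[OF reps] by metis
  show "finite R" using bij_betw_finite[OF f] finite_norm_functionals by simp
  show "card R = index"
    using bij_betw_same_card[OF f] by (simp add: card_norm_functionals index_def)
qed

lemma act_eq_0_iff:
  assumes "g \<in> GL (Suc m)" "f \<in> par_invs m"
  shows "act (Suc m) g f = 0 \<longleftrightarrow> f = 0"
proof
  assume z: "act (Suc m) g f = 0"
  obtain h where h: "h \<in> GL (Suc m)" "h * g = 1\<^sub>m (Suc m)" using GL_inverse[OF assms(1)] by metis
  have "act (Suc m) h (act (Suc m) g f) = act (Suc m) (1\<^sub>m (Suc m)) f"
    using act_act[OF GL_carrier[OF h(1)] GL_carrier[OF assms(1)], of f] h by simp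
  also have "\<dots> = f" using assms(2) one_in_parabolic by (auto simp: par_invs_def)
  finally show "f = 0" using z by simp
qed simp

lemma root_inverse:
  assumes "g \<in> GL (Suc m)"
  shows "root g * to_fract (act (Suc m) g (top_class m)) = 1"
  using act_eq_0_iff[OF assms top_class_in_par_invs[OF m]] by (simp add: root_def top_class_nonzero)

lemma root_nonzero: "g \<in> GL (Suc m) \<Longrightarrow> root g \<noteq> 0"
  using root_inverse by force

lemma act_dickson_Suc:
  assumes "g \<in> GL (Suc m)" "i \<le> Suc m"
  shows "act (Suc m) g (dickson (Suc m) i) = dickson (Suc m) i"
  using dickson_in_sym_invs[OF assms(2)] assms(1) by (auto simp: sym_invs_def)

text \<open>The coefficients of \<open>hyper i\<close> are fixed by the whole group, so one
  polynomial gives all conjugates of \<open>dickson m i\<close> at the conjugates of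
  \<open>z\<close>.\<close>

lemma poly_hyper:
  assumes g: "g \<in> GL (Suc m)" and i: "i \<le> m"
  shows "poly (hyper i) (root g) = to_fract (act (Suc m) g (dickson m i))"
  using i
proof (induction i)
  case 0
  have "to_fract (dickson (Suc m) 0) = to_fract (act (Suc m) g (dickson (Suc m) 0))"
    by (simp add: act_dickson_Suc[OF g])
  also have "\<dots> = to_fract (act (Suc m) g (top_class m)) * to_fract (act (Suc m) g (dickson m 0))"
    by (simp add: dickson_Suc_0 act.hom_mult)
  finally have "root g * to_fract (dickson (Suc m) 0) = to_fract (act (Suc m) g (dickson m 0))"
    using root_inverse[OF g] by (simp flip: mult.assoc)
  then show ?case by (simp add: hyper_def)
next
  case (Suc i)
  have "to_fract (dickson (Suc m) (Suc i)) = to_fract (act (Suc m) g (dickson (Suc m) (Suc i)))"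
    using Suc.prems by (simp add: act_dickson_Suc[OF g])
  also have "\<dots> = to_fract (act (Suc m) g (dickson m i)) ^ CARD('p) +
      to_fract (act (Suc m) g (top_class m)) * to_fract (act (Suc m) g (dickson m (Suc i)))"
    using Suc.prems
    by (simp add: dickson_Suc_Suc act.hom_mult act.hom_add act.hom_power to_fract.hom_power)
  finally have "to_fract (dickson (Suc m) (Suc i)) - to_fract (act (Suc m) g (dickson m i)) ^ CARD('p) =
      to_fract (act (Suc m) g (top_class m)) * to_fract (act (Suc m) g (dickson m (Suc i)))"
    by simp
  then have "root g * (to_fract (dickson (Suc m) (Suc i)) - to_fract (act (Suc m) g (dickson m i)) ^ CARD('p)) =
      to_fract (act (Suc m) g (dickson m (Suc i)))"
    using root_inverse[OF g] by (simp flip: mult.assoc)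
  then show ?case using Suc by (simp add: hyper_def poly_power)
qed

text \<open>Equal roots mean that the inverse of \<open>g\<close> times \<open>h\<close> fixes the
  top class; this product then lies in the parabolic group and both represent the same
  coset.\<close>

lemma root_inj: "inj_on root R"
proof (rule inj_onI)
  fix g h assume gh: "g \<in> R" "h \<in> R" and eq: "root g = root h"
  note G = R_GL[OF gh(1)] R_GL[OF gh(2)]
  have top: "act (Suc m) g (top_class m) = act (Suc m) h (top_class m)"
    using eq by (simp add: root_def)
  obtain i where i: "i \<in> GL (Suc m)" "i * g = 1\<^sub>m (Suc m)" "g * i = 1\<^sub>m (Suc m)" using GL_inverse[OF G(1)] by metis
  have "act (Suc m) (i * h) (top_class m) = act (Suc m) i (act (Suc m) g (top_class m))"
    by (simp add: top act_act GL_carrier i G)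
  also have "\<dots> = act (Suc m) (1\<^sub>m (Suc m)) (top_class m)"
    using act_act[OF GL_carrier[OF i(1)] GL_carrier[OF G(1)], of "top_class m"] i(2) by simp
  also have "\<dots> = top_class m"
    using top_class_in_par_invs[OF m] one_in_parabolic by (auto simp: par_invs_def)
  finally have ih: "i * h \<in> parabolic m (Suc 0)" by (rule act_top_class_eq_imp[OF GL_mult[OF i(1) G(2)]])
  have "h = g * (i * h)"
    using i(3) GL_carrier[OF G(2)]
    by (simp flip: assoc_mult_mat[OF GL_carrier[OF G(1)] GL_carrier[OF i(1)] GL_carrier[OF G(2)]])
  moreover have "h = h * 1\<^sub>m (Suc m)" using GL_carrier[OF G(2)] by simp
  ultimately show "g = h"
    using reps G(2) gh ih one_in_parabolic unfolding left_coset_reps_def by metis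
qed

lemma degree_hyper: "degree (hyper m) = index"
  unfolding hyper_def index_def
  by (rule degree_dickson_rec) (simp_all add: dickson_0_nonzero)

text \<open>The power sums of the roots of \<open>hyper m - 1\<close> vanish below degree \<open>index\<close>: the derivative of
  this polynomial at a root is the inverse of the root.\<close>

lemma sum_poly_roots:
  assumes "coeff Q 0 = 0" "degree Q \<le> index"
  shows "(\<Sum>g\<in>R. poly Q (root g)) = coeff Q index / lead_coeff (hyper m)"
proof -
  define F where "F = hyper m + [:- 1:]"
  have lt: "degree [:- 1 :: 'p fpoly fract:] < degree (hyper m)"
    using index_pos by (simp add: degree_hyper)
  have dF: "degree F = index" and lF: "lead_coeff F = lead_coeff (hyper m)"
    using degree_add_eq_left[OF lt] lead_coeff_add_le[OF lt] 
    by (simp_all add: F_def degree_hyper add.commute)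
  obtain k where k: "m = Suc k" using m by (cases m) auto
  have top: "poly (hyper m) (root g) = 1" if "g \<in> R" for g
    using poly_hyper[OF R_GL[OF that], of m] by simp
  have der: "poly (pderiv F) (root g) = 1 / root g" if "g \<in> R" for g
  proof -
    define c where "c = (\<lambda>i. to_fract (dickson (Suc m) i :: 'p fpoly))"
    have hyper_k: "hyper m = dickson_rec CARD('p) c (Suc k)" by (simp only: hyper_def c_def flip: k)
    have "pderiv F = pderiv (hyper m)" by (simp add: F_def pderiv_add pderiv_pCons)
    also have "\<dots> = [:c (Suc k):] - dickson_rec CARD('p) c k ^ CARD('p)"
      unfolding hyper_k by (rule pderiv_dickson_rec[OF of_nat_CARD_fract])
    finally have "hyper m = [:0, 1:] * pderiv F"
      unfolding hyper_k by (simp only: dickson_rec.simps)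
    then have "root g * poly (pderiv F) (root g) = 1"
      using top[OF that] by simp
    then show ?thesis using root_nonzero[OF R_GL[OF that]] by (simp add: field_simps)
  qed
  \<comment> \<open>Splitting off one factor z, which equals 1 / F'(z) at a root, brings the sum
    into the form required by interpolation and lowers the degree below that of
    \<open>F\<close>.\<close>
  obtain q where q: "Q = pCons 0 q" using assms(1) by (cases Q) auto
  have dq: "degree q < degree F"
    using assms(2) index_pos unfolding dF q by (cases "q = 0") auto
  have "(\<Sum>g\<in>R. poly Q (root g)) = (\<Sum>g\<in>R. poly q (root g) / poly (pderiv F) (root g))"
    using der by (intro sum.cong) (simp_all add: q)
  also have "\<dots> = (\<Sum>z\<in>root ` R. poly q z / poly (pderiv F) z)"
    by (simp add: sum.reindex[OF root_inj])
  also have "\<dots> = coeff q (degree F - 1) / lead_coeff F"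
  proof (rule sum_over_roots)
    show "finite (root ` R)" using finite_R by simp
    show "card (root ` R) = degree F" by (simp add: card_image[OF root_inj] card_R dF)
    show "poly F z = 0" "poly (pderiv F) z \<noteq> 0" if "z \<in> root ` R" for z
      using that top der root_nonzero R_GL by (auto simp: F_def)
  qed (rule dq)
  also have "coeff q (degree F - 1) = coeff Q index"
    using index_pos by (simp add: q dF coeff_pCons split: nat.split)
  finally show ?thesis unfolding lF .
qed

lemma basis_in: "basis a \<in> par_invs m"
  unfolding basis_def by (rule digit_prod_in_par_invs) simp

lemma dual_in: "dual a \<in> par_invs m"
  unfolding dual_def by (rule dual_prod_in_par_invs[OF _ m]) simp

lemma poly_basis:
  assumes "g \<in> GL (Suc m)"
  shows "poly (basis_poly a) (root g) = to_fract (act (Suc m) g (basis a))"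
proof -
  have ev: "comm_semiring_hom (\<lambda>q. poly q (root g))" by standard simp_all
  have "poly (basis_poly a) (root g) =
      digit_prod CARD('p) (\<lambda>i. to_fract (act (Suc m) g (dickson m i))) m a"
    unfolding comm_semiring_hom.hom_digit_prod[OF ev] by (rule digit_prod_cong) (rule poly_hyper[OF assms])
  then show ?thesis by (simp add: basis_def act.hom_digit_prod to_fract.hom_digit_prod)
qed

lemma poly_dual:
  assumes "g \<in> GL (Suc m)"
  shows "poly (dual_poly a) (root g) = root g ^ m * to_fract (act (Suc m) g (dual a))"
proof -
  have ev: "comm_semiring_hom (\<lambda>q. poly q (root g))" by standard simp_all
  have "poly (dual_poly a) (root g) =
      dual_prod CARD('p) (\<lambda>i. to_fract (act (Suc m) g (dickson m i))) (root g) (\<lambda>_. root g) m a"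
    unfolding comm_semiring_hom.hom_dual_prod[OF ev] poly_pCons poly_0 mult_zero_right mult_1_right add_0_left add_0_right
    by (rule dual_prod_cong) (rule poly_hyper[OF assms])
  also have "\<dots> = root g ^ m * dual_prod CARD('p) (\<lambda>i. to_fract (act (Suc m) g (dickson m i))) 1
      (\<lambda>j. to_fract (act (Suc m) g (top_class m)) ^ j) m a"
    by (rule dual_prod_scale[OF root_inverse[OF assms]])
  also have "dual_prod CARD('p) (\<lambda>i. to_fract (act (Suc m) g (dickson m i))) 1
      (\<lambda>j. to_fract (act (Suc m) g (top_class m)) ^ j) m a = to_fract (act (Suc m) g (dual a))"
    by (simp add: dual_def act.hom_dual_prod to_fract.hom_dual_prod act.hom_power to_fract.hom_power)
  finally show ?thesis .
qed

lemma c0: "to_fract (dickson (Suc m) 0 :: 'p fpoly) \<noteq> 0"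
  by (simp add: dickson_0_nonzero)

lemmas basis_degree =
  degree_digit_prod(1)[of "\<lambda>i. to_fract (dickson (Suc m) i :: 'p fpoly)" "CARD('p)" _ m, folded hyper_def index_def, OF c0 p_pos]
lemmas dual_degree =
  degree_digit_prod(2)[of "\<lambda>i. to_fract (dickson (Suc m) i :: 'p fpoly)" "CARD('p)" _ m, folded hyper_def index_def, OF c0 p_pos]
lemmas lead_basis_dual =
  degree_digit_prod(3)[of "\<lambda>i. to_fract (dickson (Suc m) i :: 'p fpoly)" "CARD('p)" _ m, folded hyper_def index_def, OF c0 p_pos]

lemma dual_poly_coeff_0: "coeff (dual_poly a) 0 = 0"
  unfolding hyper_def by (rule dual_prod_coeff_0) simp

lemma hyper_m_nonzero: "hyper m \<noteq> 0"
  using degree_hyper index_pos by auto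

text \<open>The condition \<open>a \<le> c\<close> bounds the degree a + (index - c) by
  \<open>index\<close>, the limit of the trace formula; below the diagonal nothing is
  claimed.\<close>

lemma form_basis_dual:
  assumes ac: "a \<le> c" "c < index"
  shows "form (basis a * dual c) =
    coeff (basis_poly a * dual_poly c) index / lead_coeff (hyper m)"
proof -
  have "form (basis a * dual c) = (\<Sum>g\<in>R. poly (basis_poly a * dual_poly c) (root g))"
    unfolding form_def by (intro sum.cong refl)
      (simp add: poly_basis poly_dual R_GL act.hom_mult mult_ac)
  also have "\<dots> = coeff (basis_poly a * dual_poly c) index / lead_coeff (hyper m)"
  proof (rule sum_poly_roots)
    show "coeff (basis_poly a * dual_poly c) 0 = 0" by (simp add: coeff_mult dual_poly_coeff_0)
    have "degree (basis_poly a * dual_poly c) \<le> a + (index - c)"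
      using degree_mult_le[of "basis_poly a" "dual_poly c"] ac(2) le_less_trans[OF ac]
      by (simp only: basis_degree dual_degree)
    then show "degree (basis_poly a * dual_poly c) \<le> index" using assms by linarith
  qed
  finally show ?thesis .
qed

lemma form_basis_dual_less:
  assumes "a < c" "c < index" shows "form (basis a * dual c) = 0"
proof -
  have "a < index" using assms by simp
  then have "degree (basis_poly a * dual_poly c) \<le> a + (index - c)"
    using degree_mult_le[of "basis_poly a" "dual_poly c"] assms(2)
    by (simp only: basis_degree dual_degree)
  then have "coeff (basis_poly a * dual_poly c) index = 0"
    using assms by (intro coeff_eq_0) linarith
  then show ?thesis using form_basis_dual[of a c] assms by simp
qed

lemma form_basis_dual_eq:
  assumes "a < index" shows "\<exists>k. form (basis a * dual a) = (-1) ^ k"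
proof -
  obtain k where k: "lead_coeff (basis_poly a) * lead_coeff (dual_poly a) = (-1) ^ k * lead_coeff (hyper m)"
    using lead_basis_dual[OF assms] by blast
  have deg: "degree (basis_poly a) = a" "degree (dual_poly a) = index - a"
    using assms by (simp_all add: basis_degree dual_degree)
  have "coeff (basis_poly a * dual_poly a) index = coeff (basis_poly a * dual_poly a) (degree (basis_poly a) + degree (dual_poly a))"
    using assms by (simp add: deg)
  also have "\<dots> = (-1) ^ k * lead_coeff (hyper m)"
    by (simp only: coeff_mult_degree_sum k)
  finally show ?thesis using form_basis_dual[of a a] assms hyper_m_nonzero by auto
qed

section \<open>Linearity, integrality and nondegeneracy of the form\<close>

lemma form_add: "form (f + g) = form f + form g"
  by (simp add: form_def act.hom_add sum.distrib algebra_simps)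

lemma form_diff: "form (f - g) = form f - form g"
  by (simp add: form_def act.hom_minus sum_subtractf algebra_simps)

lemma form_0: "form 0 = 0"
  by (simp add: form_def)

lemma form_sum: "form (sum F A) = (\<Sum>x\<in>A. form (F x))"
  by (induction A rule: infinite_finite_induct) (simp_all add: form_0 form_add)

lemma form_scale:
  assumes "x \<in> sym_invs m" shows "form (x * f) = to_fract x * form f"
  using assms R_GL by (auto simp: form_def act.hom_mult sum_distrib_left sym_invs_def mult.assoc intro!: sum.cong)

text \<open>Multiplying by the m-th power of \<open>dickson (Suc m) 0\<close> turns each weight z^m
  into the m-th power of the conjugate of \<open>dickson m 0\<close>, so the form becomes the
  transfer treated in \<open>transfer_divisible\<close>.\<close>

lemma form_integral:
  assumes "f \<in> par_invs m"
  obtains y where "y \<in> sym_invs m" "form f = to_fract y"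
proof -
  obtain q where q: "q \<in> sym_invs m"
    "transfer (Suc m) R (f * dickson m 0 ^ m) = dickson (Suc m) 0 ^ m * q"
    using transfer_divisible[OF reps assms] by metis
  have "to_fract (dickson (Suc m) 0) ^ m * form f = to_fract (transfer (Suc m) R (f * dickson m 0 ^ m))"
    unfolding form_def transfer_def sum_distrib_left to_fract.hom_sum
  proof (intro sum.cong refl)
    fix g assume g: "g \<in> R"
    have "to_fract (dickson (Suc m) 0) * root g = to_fract (act (Suc m) g (dickson m 0))"
      using poly_hyper[OF R_GL[OF g], of 0] by (simp add: hyper_def mult.commute)
    then have "to_fract (act (Suc m) g (dickson m 0)) ^ m = to_fract (dickson (Suc m) 0) ^ m * root g ^ m"
      by (simp flip: power_mult_distrib)
    then show "to_fract (dickson (Suc m) 0) ^ m * (to_fract (act (Suc m) g f) * root g ^ m) =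
        to_fract (act (Suc m) g (f * dickson m 0 ^ m))"
      by (simp add: act.hom_mult act.hom_power to_fract.hom_power mult_ac)
  qed
  then have "to_fract (dickson (Suc m) 0) ^ m * form f = to_fract (dickson (Suc m) 0) ^ m * to_fract q"
    by (simp add: q to_fract.hom_power)
  then have "form f = to_fract q" using c0 by simp
  then show ?thesis using that q by blast
qed

text \<open>The dual polynomials have each degree from 1 to \<open>index\<close> once and no
  constant term, so they span all polynomials of this kind. Orthogonality thus extends to a
  polynomial vanishing at all roots but one, which isolates a single conjugate of
  \<open>f\<close>.\<close>

lemma form_nondegenerate:
  assumes f: "f \<in> par_invs m" and orth: "\<And>c. c < index \<Longrightarrow> form (f * dual c) = 0"
  shows "f = 0"
proof -
  let ?L = "\<lambda>Q. \<Sum>g\<in>R. to_fract (act (Suc m) g f) * poly Q (root g)"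
  have Ld: "?L (dual_poly c) = 0" if "c < index" for c
  proof -
    have "?L (dual_poly c) = form (f * dual c)"
      unfolding form_def by (intro sum.cong refl) (simp add: poly_dual R_GL act.hom_mult mult_ac)
    then show ?thesis using orth that by simp
  qed
  have L: "?L Q = 0" if "degree Q \<le> index" "coeff Q 0 = 0" for Q
    using that
  proof (induction "degree Q" arbitrary: Q rule: less_induct)
    case less
    show ?case
    proof (cases "degree Q = 0")
      case True
      then have "Q = 0" using less.prems(2) by (metis leading_coeff_0_iff)
      then show ?thesis by simp
    next
      case False
      define c where "c = index - degree Q"
      have c: "c < index" "index - c = degree Q" using False less.prems(1) index_pos by (auto simp: c_def)
      let ?D = "dual_poly c"
      have dD: "degree ?D = degree Q" using dual_degree[OF c(1)] c(2) by simp
      then have lD: "coeff ?D (degree Q) \<noteq> 0" using False by (metis degree_0 leading_coeff_0_iff)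
      define t where "t = lead_coeff Q / coeff ?D (degree Q)"
      define Q' where "Q' = Q - smult t ?D"
      have "degree Q' \<le> degree Q"
        unfolding Q'_def using dD by (intro degree_diff_le) (auto intro: order_trans[OF degree_smult_le])
      moreover have "coeff Q' (degree Q) = 0" using lD by (simp add: Q'_def t_def)
      ultimately have "degree Q' < degree Q"
        using False by (metis degree_0 leading_coeff_0_iff le_neq_implies_less not_gr_zero)
      moreover have "coeff Q' 0 = 0" using less.prems by (simp add: Q'_def dual_poly_coeff_0)
      ultimately have "?L Q' = 0" using less by simp
      moreover have "?L Q = ?L Q' + t * ?L ?D"
        by (simp add: Q'_def sum_distrib_left algebra_simps flip: sum.distrib)
      ultimately show ?thesis using Ld[OF c(1)] by simp
    qed
  qed
  have "R \<noteq> {}" using card_R index_pos by auto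
  then obtain h where h: "h \<in> R" by blast
  define Q where "Q = [:0, 1:] * (\<Prod>g\<in>R - {h}. [:- root g, 1:])"
  have "degree (\<Prod>g\<in>R - {h}. [:- root g, 1:]) = index - 1"
    using finite_R h by (subst degree_prod_eq_sum_degree) (simp_all add: card_Diff_singleton card_R)
  then have "degree Q \<le> index"
    unfolding Q_def using degree_mult_le[of "[:0, 1:]" "\<Prod>g\<in>R - {h}. [:- root g, 1:]"] index_pos by simp
  moreover have "coeff Q 0 = 0" by (simp add: Q_def)
  ultimately have "?L Q = 0" by (rule L)
  also have "?L Q = (\<Sum>g\<in>{h}. to_fract (act (Suc m) g f) * poly Q (root g))"
    using finite_R h by (intro sum.mono_neutral_right) (auto simp: Q_def poly_prod)
  finally have "to_fract (act (Suc m) h f) * poly Q (root h) = 0" by simp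
  moreover have "poly Q (root h) \<noteq> 0"
    using finite_R h root_inj root_nonzero[OF R_GL[OF h]] by (auto simp: Q_def poly_prod inj_on_def)
  ultimately have "act (Suc m) h f = 0" by simp
  then show ?thesis using act_eq_0_iff[OF R_GL[OF h] f] by simp
qed

subsection \<open>The basis\<close>

text \<open>Back substitution in the Gram matrix, from the highest basis element down:
  \<open>k\<close> counts those not yet subtracted. Pairing with \<open>dual k\<close> gives the
  next coefficient up to sign, and the subtraction leaves the pairings with higher duals at zero.
  The final remainder is orthogonal to all duals.\<close>

lemma basis_spans:
  fixes f :: "'p fpoly"
  assumes "f \<in> par_invs m"
  shows "\<exists>x. (\<forall>a. x a \<in> sym_invs m) \<and> f = (\<Sum>a<index. x a * basis a)"
proof -
  have "\<exists>x. (\<forall>a. x a \<in> sym_invs m) \<and> f = (\<Sum>a<index. x a * basis a)"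
    if "k \<le> index" "f \<in> par_invs m" "\<And>c. k \<le> c \<Longrightarrow> c < index \<Longrightarrow> form (f * dual c) = 0" for k f
    using that
  proof (induction k arbitrary: f)
    case 0
    then have "f = 0" using form_nondegenerate by simp
    then show ?case by (intro exI[of _ "\<lambda>_. 0"]) (simp add: sym_invs_ring)
  next
    case (Suc k)
    have k: "k < index" using Suc.prems by simp
    obtain y where y: "y \<in> sym_invs m" "form (f * dual k) = to_fract y"
      using form_integral par_invs_ring(7)[OF Suc.prems(2) dual_in] by metis
    obtain j where j: "form (basis k * dual k) = (-1) ^ j" using form_basis_dual_eq[OF k] by blast
    \<comment> \<open>The diagonal entry is its own inverse, so no denominator arises.\<close>
    define t where "t = (-1) ^ j * y"
    have t: "t \<in> sym_invs m" unfolding t_def by (intro sym_invs_ring y)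
    define f' where "f' = f - t * basis k"
    have f': "f' \<in> par_invs m"
      unfolding f'_def using t sym_invs_subset by (intro par_invs_ring Suc.prems basis_in) blast
    have ff: "form (f' * dual c) = form (f * dual c) - to_fract t * form (basis k * dual c)" for c
      unfolding f'_def left_diff_distrib form_diff mult.assoc form_scale[OF t] ..
    have "form (f' * dual c) = 0" if c: "k \<le> c" "c < index" for c
    proof (cases "c = k")
      case True
      have "to_fract t * (-1) ^ j = to_fract y"
        by (simp add: t_def to_fract.hom_power to_fract.hom_uminus mult.assoc mult.left_commute flip: power_mult_distrib)
      then show ?thesis unfolding ff True y j by simp
    next
      case False
      then show ?thesis unfolding ff using c Suc.prems(3) form_basis_dual_less by simp
    qed
    then obtain x where x: "\<forall>a. x a \<in> sym_invs m" "f' = (\<Sum>a<index. x a * basis a)"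
      using Suc.IH[OF _ f'] Suc.prems(1) by auto
    define x' where "x' = (\<lambda>a. x a + (if a = k then t else 0))"
    have "(\<Sum>a<index. x' a * basis a) = f' + (\<Sum>a<index. if a = k then t * basis k else 0)"
      unfolding x(2) x'_def distrib_right sum.distrib
    by (intro arg_cong2[where f = "(+)"] sum.cong refl) simp
    also have "\<dots> = f" using k by (simp add: f'_def)
    finally have "f = (\<Sum>a<index. x' a * basis a)" ..
    moreover have "\<forall>a. x' a \<in> sym_invs m" using x(1) t by (auto simp: x'_def intro!: sym_invs_ring)
    ultimately show ?case by blast
  qed
  from this[of index f] assms show ?thesis by simp
qed

text \<open>Pair with the dual element of the largest index \<open>e\<close> that has a nonzero
  coefficient; triangularity removes all smaller indices.\<close>

lemma basis_independent:
  assumes x: "\<And>a. a < index \<Longrightarrow> x a \<in> sym_invs m" and sum: "(\<Sum>a<index. x a * basis a) = 0"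
    and c: "c < index"
  shows "x c = 0"
proof (rule ccontr)
  assume "x c \<noteq> 0"
  define M where "M = {a. a < index \<and> x a \<noteq> 0}"
  have M: "finite M" "M \<noteq> {}" using \<open>x c \<noteq> 0\<close> c by (auto simp: M_def)
  define e where "e = Max M"
  have "e \<in> M" using M by (simp add: e_def)
  then have e: "e < index" "x e \<noteq> 0" by (auto simp: M_def)
  have above: "x a = 0" if "e < a" "a < index" for a
  proof (rule ccontr)
    assume "x a \<noteq> 0"
    then have "a \<in> M" using that by (simp add: M_def)
    then have "a \<le> e" using M by (simp add: e_def)
    then show False using that by simp
  qed
  have "0 = form ((\<Sum>a<index. x a * basis a) * dual e)" by (simp add: sum form_0)
  also have "\<dots> = (\<Sum>a<index. to_fract (x a) * form (basis a * dual e))"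
    unfolding sum_distrib_right form_sum mult.assoc by (intro sum.cong refl form_scale x) simp
  also have "\<dots> = (\<Sum>a\<in>{e}. to_fract (x a) * form (basis a * dual e))"
  proof (rule sum.mono_neutral_right)
    show "\<forall>a\<in>{..<index} - {e}. to_fract (x a) * form (basis a * dual e) = 0"
    proof
      fix a assume "a \<in> {..<index} - {e}"
      then consider "a < e" | "e < a" "a < index" by fastforce
      then show "to_fract (x a) * form (basis a * dual e) = 0"
        using form_basis_dual_less[OF _ e(1)] above by cases simp_all
    qed
  qed (use e in auto)
  finally show False using form_basis_dual_eq[OF e(1)] e(2) by auto
qed

text \<open>\<open>basis_B\<close> is a set, so coincidences must be excluded before sums over it
  can be written as sums over the numbers below \<open>index\<close>.\<close>

lemma basis_inj: "inj_on basis {..<index}"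
proof (rule inj_onI, rule ccontr)
  fix a c assume ac: "a \<in> {..<index}" "c \<in> {..<index}" "basis a = basis c" "a \<noteq> c"
  define x where "x = (\<lambda>i. if i = a then 1 else if i = c then - 1 else 0 :: 'p fpoly)"
  have "(\<Sum>i<index. x i * basis i) = (\<Sum>i\<in>{a, c}. x i * basis i)"
    using ac by (intro sum.mono_neutral_right) (auto simp: x_def)
  also have "\<dots> = 0" using ac by (simp add: x_def)
  finally have sum: "(\<Sum>i<index. x i * basis i) = 0" .
  have "x i \<in> sym_invs m" for i
    using sym_invs_ring(2)[of "Suc m"] sym_invs_ring(3)[of "Suc m"]
      sym_invs_ring(6)[OF sym_invs_ring(3)[of "Suc m"]]
    by (auto simp: x_def)
  then have "x a = 0" by (rule basis_independent[OF _ sum]) (use ac in simp)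
  then show False by (simp add: x_def)
qed

lemma transfer_scale:
  "x \<in> sym_invs m \<Longrightarrow> transfer (Suc m) R (x * f) = x * transfer (Suc m) R f"
  using R_GL by (auto simp: transfer_def act.hom_mult sum_distrib_left sym_invs_def intro!: sum.cong)

text \<open>For \<open>a = 0\<close> the transfer counts cosets, and \<open>index\<close> is 1 plus
  a multiple of p. Otherwise the basis polynomial has no constant term and a degree below
  \<open>index\<close>, so the coefficient in \<open>sum_poly_roots\<close> is zero.\<close>

lemma transfer_basis:
  assumes "a < index"
  shows "transfer (Suc m) R (basis a) = (if a = 0 then 1 else 0)"
proof (cases "a = 0")
  case True
  have "(of_nat index :: 'p fpoly) = 1"
    using of_nat_CHAR[where ?'a = "'p fpoly"] by (simp add: index_def repunit_Suc CHAR_fpoly)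
  then show ?thesis using True by (simp add: transfer_def basis_def card_R)
next
  case False
  have "to_fract (transfer (Suc m) R (basis a)) = (\<Sum>g\<in>R. poly (basis_poly a) (root g))"
    by (simp add: transfer_def to_fract.hom_sum poly_basis R_GL)
  also have "\<dots> = coeff (basis_poly a) index / lead_coeff (hyper m)"
  proof (rule sum_poly_roots)
    show "coeff (basis_poly a) 0 = 0"
      using assms False by (intro digit_prod_coeff_0) (simp_all add: hyper_def index_def)
    show "degree (basis_poly a) \<le> index" using assms by (simp add: basis_degree)
  qed
  also have "coeff (basis_poly a) index = 0"
    using assms by (intro coeff_eq_0) (simp add: basis_degree)
  finally show ?thesis using False by simp
qed

lemma basis_B_eq: "basis_B (Suc m) = basis ` {..<index}"
proof -
  have "basis ` {..<index} = digit_prod CARD('p) (dickson m) m ` {..<repunit CARD('p) (Suc m)}"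
    by (simp add: basis_def index_def)
  then show ?thesis unfolding basis_B_def
    using digit_prod_image[OF p_pos, where d = "dickson m :: nat \<Rightarrow> 'p fpoly" and m = m]
    by (simp only: diff_Suc_1)
qed

lemma expansion_iff:
  "expansion (sym_invs m) (basis_B (Suc m)) f c \<longleftrightarrow>
    c \<in> basis_B (Suc m) \<rightarrow>\<^sub>E sym_invs m \<and> f = (\<Sum>a<index. c (basis a) * basis a)"
  unfolding expansion_def basis_B_eq by (simp add: sum.reindex[OF basis_inj])

lemma expansion_exists_unique:
  fixes f :: "'p fpoly"
  assumes "f \<in> par_invs m"
  shows "\<exists>!c. expansion (sym_invs m) (basis_B (Suc m)) f c"
proof -
  obtain x where x: "\<forall>a. x a \<in> sym_invs m" "f = (\<Sum>a<index. x a * basis a)"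
    using basis_spans[OF assms] by blast
  \<comment> \<open>\<open>restrict\<close> gives the default value outside the basis that the
    extensional function space in \<open>expansion\<close> demands; uniqueness of the coefficient
    function depends on it.\<close>
  define c where "c = restrict (\<lambda>b. x (the_inv_into {..<index} basis b)) (basis_B (Suc m))"
  have cb: "c (basis a) = x a" if "a < index" for a
    using that by (simp add: c_def basis_B_eq the_inv_into_f_f[OF basis_inj])
  show ?thesis
  proof (rule ex1I[of _ c])
    show "expansion (sym_invs m) (basis_B (Suc m)) f c"
      unfolding expansion_iff using x by (auto simp: cb) (auto simp: c_def)
  next
    fix c' assume "expansion (sym_invs m) (basis_B (Suc m)) f c'"
    then have c': "c' \<in> basis_B (Suc m) \<rightarrow>\<^sub>E sym_invs m" "f = (\<Sum>a<index. c' (basis a) * basis a)"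
      by (auto simp: expansion_iff)
    have c'in: "c' (basis a) \<in> sym_invs m" if "a < index" for a
      using c'(1) that by (auto simp: basis_B_eq)
    have "(\<Sum>a<index. (c' (basis a) - x a) * basis a) = 0"
      using x(2) c'(2) by (simp add: left_diff_distrib sum_subtractf)
    then have eq: "c' (basis a) - x a = 0" if "a < index" for a
      by (rule basis_independent[rotated]) (use that x(1) c'in in \<open>auto intro!: sym_invs_ring\<close>)
    show "c' = c"
    proof
      fix b
      show "c' b = c b"
      proof (cases "b \<in> basis_B (Suc m)")
        case True
        then obtain a where "a < index" "b = basis a" by (auto simp: basis_B_eq)
        then show ?thesis using eq[of a] cb[of a] by simp
      next
        case False
        then show ?thesis using PiE_arb[OF c'(1) False] by (simp add: c_def)
      qed
    qed
  qed
qed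

lemma basis_0: "basis 0 = 1"
  by (simp add: basis_def)

text \<open>Both maps are linear over the Dickson algebra and agree on the basis: the transfer of
  the expansion retains only the coefficient of \<open>basis 0 = 1\<close>.\<close>

lemma natural_epi_eq_transfer:
  fixes f :: "'p fpoly"
  assumes "f \<in> par_invs m"
  shows "natural_epi (sym_invs m) (basis_B (Suc m)) f = transfer (Suc m) R f"
proof -
  define c where "c = (THE c. expansion (sym_invs m) (basis_B (Suc m)) f c)"
  have "expansion (sym_invs m) (basis_B (Suc m)) f c"
    unfolding c_def by (rule theI'[OF expansion_exists_unique[OF assms]])
  then have c: "c \<in> basis_B (Suc m) \<rightarrow>\<^sub>E sym_invs m" "f = (\<Sum>a<index. c (basis a) * basis a)"
    by (auto simp: expansion_iff)
  have cin: "c (basis a) \<in> sym_invs m" if "a < index" for a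
    using c(1) that by (auto simp: basis_B_eq)
  have "transfer (Suc m) R f = (\<Sum>a<index. transfer (Suc m) R (c (basis a) * basis a))"
    by (subst c(2)) (simp add: transfer_def act.hom_sum sum.swap[of _ R])
  also have "\<dots> = (\<Sum>a<index. if a = 0 then c 1 else 0)"
    by (intro sum.cong refl) (simp add: transfer_scale cin transfer_basis basis_0)
  also have "\<dots> = c 1" using index_pos by simp
  finally show ?thesis by (simp add: natural_epi_def c_def)
qed

lemma basis_B_free: "finite_free_basis (sym_invs m) (par_invs m) (basis_B (Suc m) :: 'p fpoly set)"
  unfolding finite_free_basis_def
proof (intro conjI ballI)
  show "finite (basis_B (Suc m) :: 'p fpoly set)" by (simp add: basis_B_eq)
  show "basis_B (Suc m) \<subseteq> (par_invs m :: 'p fpoly set)" using basis_in by (auto simp: basis_B_eq)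
qed (rule expansion_exists_unique)

lemma one_in_basis_B: "1 \<in> (basis_B (Suc m) :: 'p fpoly set)"
  unfolding basis_B_eq using index_pos basis_0 by (metis imageI lessThan_iff)

end

theorem theorem41:
  fixes n :: nat and R :: "'p::prime_card mod_ring mat set"
  assumes "odd CARD('p)" and "n \<ge> 2"
    and "left_coset_reps R (GL n) (parabolic (n - 1) 1)"
  shows "finite_free_basis (invariants n (GL n)) (invariants n (parabolic (n - 1) 1))
           (basis_B n :: 'p fpoly set) \<and>
         1 \<in> (basis_B n :: 'p fpoly set) \<and>
         (\<forall>f \<in> invariants n (parabolic (n - 1) 1).
            natural_epi (invariants n (GL n)) (basis_B n) f = transfer n R f)"
proof -
  obtain m where n: "n = Suc m" and m: "m \<ge> 1" using assms(2) by (cases n) auto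
  interpret coset_system m R
    using assms(3) m by unfold_locales (simp_all add: n)
  show ?thesis
    using basis_B_free one_in_basis_B natural_epi_eq_transfer by (simp add: n)
qed

end
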